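(* Let $r>0$ and let $\Omega$ be a domain in the ball $B(r)=\{q\in\mathbb{H}:|q|<r\}$ such that $0\notin\overline\Omega$ and $\mathrm{b}\,\Omega=\Gamma\cup\Sigma$, with $\Gamma\subset B(r)$ and $\Sigma\subset\mathrm{b}B(r)$. Let $F$ be an $\mathbb{H}$-holomorphic function on a neighborhood of $\overline\Omega$. Then $F|_\Omega$ depends only on $F|_\Gamma$; that is, if $F$ and $F'$ are $\mathbb{H}$-holomorphic functions on neighborhoods of $\overline\Omega$ with $F|_\Gamma=F'|_\Gamma$, then $F|_\Omega=F'|_\Omega$.
   Context: A domain is a connected open set; $\mathrm{b}$ denotes the boundary. $\mathbb{H}$ is the quaternion algebra with real basis $\mathsf{i}_0=1,\mathsf{i}_1=\mathsf{i},\mathsf{i}_2=\mathsf{j},\mathsf{i}_3=\mathsf{k}$, and $q=\sum_{\alpha=0}^3x_\alpha\mathsf{i}_\alpha$. A $C^1$ function $F$ from an open subset of $\mathbb{H}$ to $\mathbb{H}$ is (left) $\mathbb{H}$-holomorphic if $\frac{\partial F}{\partial\bar q}:=\sum_{\alpha=0}^3\mathsf{i}_\alpha\frac{\partial F}{\partial x_\alpha}=0$. *)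

theory Defs
  imports "HOL-Analysis.Analysis"
begin

codatatype quat = Quat (Re0: real) (Im1: real) (Im2: real) (Im3: real)

lemma quat_eq_iff:
  "p = q \<longleftrightarrow> Re0 p = Re0 q \<and> Im1 p = Im1 q \<and> Im2 p = Im2 q \<and> Im3 p = Im3 q"
  by (auto intro: quat.expand)

instantiation quat :: real_vector
begin

primcorec zero_quat where
  "Re0 0 = 0" | "Im1 0 = 0" | "Im2 0 = 0" | "Im3 0 = 0"

primcorec plus_quat where
  "Re0 (p + q) = Re0 p + Re0 q" | "Im1 (p + q) = Im1 p + Im1 q"
| "Im2 (p + q) = Im2 p + Im2 q" | "Im3 (p + q) = Im3 p + Im3 q"

primcorec uminus_quat where
  "Re0 (- p) = - Re0 p" | "Im1 (- p) = - Im1 p"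
| "Im2 (- p) = - Im2 p" | "Im3 (- p) = - Im3 p"

primcorec minus_quat where
  "Re0 (p - q) = Re0 p - Re0 q" | "Im1 (p - q) = Im1 p - Im1 q"
| "Im2 (p - q) = Im2 p - Im2 q" | "Im3 (p - q) = Im3 p - Im3 q"

primcorec scaleR_quat where
  "Re0 (r *\<^sub>R p) = r * Re0 p" | "Im1 (r *\<^sub>R p) = r * Im1 p"
| "Im2 (r *\<^sub>R p) = r * Im2 p" | "Im3 (r *\<^sub>R p) = r * Im3 p"

instance
  by standard (unfold quat_eq_iff, simp_all add: algebra_simps)

end

instantiation quat :: real_algebra_1
begin

primcorec one_quat where
  "Re0 1 = 1" | "Im1 1 = 0" | "Im2 1 = 0" | "Im3 1 = 0"

primcorec times_quat where
  "Re0 (p * q) = Re0 p * Re0 q - Im1 p * Im1 q - Im2 p * Im2 q - Im3 p * Im3 q"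
| "Im1 (p * q) = Re0 p * Im1 q + Im1 p * Re0 q + Im2 p * Im3 q - Im3 p * Im2 q"
| "Im2 (p * q) = Re0 p * Im2 q - Im1 p * Im3 q + Im2 p * Re0 q + Im3 p * Im1 q"
| "Im3 (p * q) = Re0 p * Im3 q + Im1 p * Im2 q - Im2 p * Im1 q + Im3 p * Re0 q"

instance
  by standard (unfold quat_eq_iff, simp_all add: algebra_simps)

end

instantiation quat :: real_inner
begin

definition inner_quat :: "quat \<Rightarrow> quat \<Rightarrow> real" where
  "p \<bullet> q = Re0 p * Re0 q + Im1 p * Im1 q + Im2 p * Im2 q + Im3 p * Im3 q"

definition norm_quat :: "quat \<Rightarrow> real" where
  "norm p = sqrt ((Re0 p)\<^sup>2 + (Im1 p)\<^sup>2 + (Im2 p)\<^sup>2 + (Im3 p)\<^sup>2)"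

definition sgn_quat :: "quat \<Rightarrow> quat" where
  "sgn (p :: quat) = p /\<^sub>R norm p"

definition dist_quat :: "quat \<Rightarrow> quat \<Rightarrow> real" where
  "dist (p :: quat) q = norm (p - q)"

definition uniformity_quat :: "(quat \<times> quat) filter" where
  "uniformity = (INF e\<in>{0<..}. principal {(p :: quat, q). dist p q < e})"

definition open_quat :: "quat set \<Rightarrow> bool" where
  "open (U :: quat set) \<longleftrightarrow> (\<forall>p\<in>U. eventually (\<lambda>(p', q). p' = p \<longrightarrow> q \<in> U) uniformity)"

instance
proof
  fix p q s :: quat and r :: real and U :: "quat set"
  show "dist p q = norm (p - q)"
    by (rule dist_quat_def)
  show "sgn p = p /\<^sub>R norm p"
    by (rule sgn_quat_def)
  show "uniformity = (INF e\<in>{0<..}. principal {(p, q :: quat). dist p q < e})"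
    by (rule uniformity_quat_def)
  show "open U \<longleftrightarrow> (\<forall>p\<in>U. eventually (\<lambda>(p', q). p' = p \<longrightarrow> q \<in> U) uniformity)"
    by (rule open_quat_def)
  show "p \<bullet> q = q \<bullet> p"
    by (simp add: inner_quat_def)
  show "(p + q) \<bullet> s = p \<bullet> s + q \<bullet> s" "(r *\<^sub>R p) \<bullet> q = r * (p \<bullet> q)"
    by (simp_all add: inner_quat_def algebra_simps)
  show "0 \<le> p \<bullet> p"
    by (simp add: inner_quat_def)
  show "p \<bullet> p = 0 \<longleftrightarrow> p = 0"
    by (simp add: inner_quat_def quat_eq_iff add_nonneg_eq_0_iff)
  show "norm p = sqrt (p \<bullet> p)"
    by (simp add: inner_quat_def norm_quat_def power2_eq_square)
qed

end

instantiation quat :: real_normed_div_algebra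
begin

definition inverse_quat :: "quat \<Rightarrow> quat" where
  "inverse p = Quat (Re0 p) (- Im1 p) (- Im2 p) (- Im3 p) /\<^sub>R (norm p)\<^sup>2"

definition divide_quat :: "quat \<Rightarrow> quat \<Rightarrow> quat" where
  "(p :: quat) div q = p * inverse q"

instance
proof
  fix p q :: quat
  show "p div q = p * inverse q"
    by (rule divide_quat_def)
  show "inverse (0 :: quat) = 0"
    by (simp add: inverse_quat_def)
  show "norm (p * q) = norm p * norm q"
    unfolding norm_quat_def real_sqrt_mult[symmetric]
    by (rule arg_cong[where f = sqrt]) (simp add: power2_eq_square algebra_simps)
  assume "p \<noteq> 0"
  then have "(norm p)\<^sup>2 \<noteq> 0"
    by simp
  moreover have "(norm p)\<^sup>2 = Re0 p * Re0 p + Im1 p * Im1 p + Im2 p * Im2 p + Im3 p * Im3 p"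
    by (simp add: power2_norm_eq_inner inner_quat_def)
  ultimately show "inverse p * p = 1" "p * inverse p = 1"
    by (auto simp: inverse_quat_def quat_eq_iff divide_simps algebra_simps)
qed

end

text \<open>The basis \<open>\<i>\<^sub>0 = 1, \<i>\<^sub>1, \<i>\<^sub>2, \<i>\<^sub>3\<close>; only indices \<open>\<alpha> \<le> 3\<close> are meaningful.\<close>

definition quat_unit :: "nat \<Rightarrow> quat" where
  "quat_unit \<alpha> = [1, Quat 0 1 0 0, Quat 0 0 1 0, Quat 0 0 0 1] ! \<alpha>"

lemma quat_unit_simps [simp]:
  "quat_unit 0 = 1" "quat_unit (Suc 0) = Quat 0 1 0 0" "quat_unit 2 = Quat 0 0 1 0"
  "quat_unit 3 = Quat 0 0 0 1"
  by (simp_all add: quat_unit_def)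

lemma quat_unit_mult:
  "quat_unit 1 * quat_unit 1 = -1" "quat_unit 2 * quat_unit 2 = -1" "quat_unit 3 * quat_unit 3 = -1"
  "quat_unit 1 * quat_unit 2 = quat_unit 3" "quat_unit 2 * quat_unit 3 = quat_unit 1"
  "quat_unit 3 * quat_unit 1 = quat_unit 2"
  "quat_unit 2 * quat_unit 1 = - quat_unit 3" "quat_unit 3 * quat_unit 2 = - quat_unit 1"
  "quat_unit 1 * quat_unit 3 = - quat_unit 2"
  by (simp_all add: quat_eq_iff)

instantiation quat :: euclidean_space
begin

definition Basis_quat :: "quat set" where
  "Basis = quat_unit ` {..3}"

instance
proof
  have B: "(Basis :: quat set) = {1, Quat 0 1 0 0, Quat 0 0 1 0, Quat 0 0 0 1}"
    unfolding Basis_quat_def by (auto simp: quat_unit_def numeral_3_eq_3 atMost_Suc)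
  show "(Basis :: quat set) \<noteq> {}" "finite (Basis :: quat set)"
    by (simp_all add: B)
  fix u v :: quat
  show "u \<in> Basis \<Longrightarrow> v \<in> Basis \<Longrightarrow> u \<bullet> v = (if u = v then 1 else 0)"
    by (auto simp: B inner_quat_def quat_eq_iff)
  show "(\<forall>u\<in>Basis. v \<bullet> u = 0) \<longleftrightarrow> v = 0"
    by (simp add: B inner_quat_def quat_eq_iff[of v])
qed

end

definition quat_partial :: "nat \<Rightarrow> (quat \<Rightarrow> quat) \<Rightarrow> quat \<Rightarrow> quat" where
  "quat_partial \<alpha> F q = vector_derivative (\<lambda>t. F (q + t *\<^sub>R quat_unit \<alpha>)) (at 0)"

text \<open>The units multiply the derivatives from the left.\<close>

definition dbar :: "(quat \<Rightarrow> quat) \<Rightarrow> quat \<Rightarrow> quat" where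
  "dbar F q = (\<Sum>\<alpha>\<le>3. quat_unit \<alpha> * quat_partial \<alpha> F q)"

definition C1_on :: "quat set \<Rightarrow> (quat \<Rightarrow> quat) \<Rightarrow> bool" where
  "C1_on U F \<longleftrightarrow>
    (\<exists>D :: quat \<Rightarrow> quat \<Rightarrow>\<^sub>L quat.
      (\<forall>q\<in>U. (F has_derivative blinfun_apply (D q)) (at q)) \<and> continuous_on U D)"

definition H_holomorphic_on :: "(quat \<Rightarrow> quat) \<Rightarrow> quat set \<Rightarrow> bool" where
  "H_holomorphic_on F U \<longleftrightarrow> open U \<and> C1_on U F \<and> (\<forall>q\<in>U. dbar F q = 0)"

end

theory Submission
  imports Defs
begin

text \<open>
  Let \<open>G = F - F'\<close> and extend it by zero from \<open>\<Omega>\<close> to the ball; the extension vanishes near the origin.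
  Unique continuation comes from a Carleman inequality for functions \<open>w\<close> supported in an annulus
  \<open>a \<le> |q| \<le> b\<close>, with a constant independent of \<open>\<tau>\<close>:
  \<open>\<parallel>w\<parallel> \<le> S \<parallel>q\<^sup>* D w + \<tau> w\<parallel>\<close> in \<open>L\<^sup>2\<close>, where \<open>D\<close> is the Dirac operator, \<open>q\<^sup>*\<close> the conjugate
  of \<open>q\<close>, and \<open>exp S > b / a\<close>. It holds because, up to an
  operator symmetric and commuting with dilations, \<open>q\<^sup>* D\<close> is the generator of the dilations. It is applied to
  \<open>w = |q| powr -2n * \<phi> * \<eta> * G\<close> with a radial cutoff \<open>\<phi>\<close> and the slowly varying truncation
  \<open>\<eta> = (max 0 (1 + \<delta> ln |G|\<^sup>2))\<^sup>2\<close>, which makes \<open>w\<close> continuously differentiable across the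
  frontier of \<open>\<Omega>\<close> without any regularity of \<open>\<Omega>\<close> and whose contribution to \<open>D w\<close> is of size
  \<open>\<delta>\<close>. Letting first \<open>\<delta>\<close> tend to 0 and then \<open>n\<close> to infinity forces \<open>G = 0\<close>.
\<close>

subsection \<open>Integrals of compactly supported functions\<close>

lemma integrable_compact_support:
  fixes f :: "'a::euclidean_space \<Rightarrow> real"
  assumes cont: "continuous_on UNIV f" and supp: "\<And>x. norm x > b \<Longrightarrow> f x = 0"
  shows "integrable lborel f"
proof -
  have "integrable lborel (\<lambda>x. indicator (cball 0 b) x *\<^sub>R f x)"
    by (intro borel_integrable_compact compact_cball continuous_on_subset[OF cont]) auto
  also have "(\<lambda>x. indicator (cball 0 b) x *\<^sub>R f x) = f"
    using supp by (force simp: indicator_def fun_eq_iff)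
  finally show ?thesis .
qed

text \<open>Change of variables; it serves once as translation invariance (\<open>c = 1\<close>) and
  once as the scaling law of dilations (\<open>t = 0\<close>).\<close>

lemma integral_lborel_affine:
  fixes f :: "'a::euclidean_space \<Rightarrow> real"
  assumes [measurable]: "f \<in> borel_measurable borel" and c: "c \<noteq> 0"
  shows "(LINT x|lborel. \<bar>c\<bar> ^ DIM('a) * f (t + c *\<^sub>R x)) = (LINT x|lborel. f x)"
  by (subst (2) lborel_affine[OF c, of t])
    (simp add: integral_density integral_distr)

text \<open>Passes to the gauge integral over a box, for which the Leibniz rule is
  available.\<close>

lemma integral_lborel_eq_cbox:
  fixes f :: "'a::euclidean_space \<Rightarrow> real"
  assumes cont: "continuous_on UNIV f" and supp: "\<And>x. x \<notin> cbox u v \<Longrightarrow> f x = 0"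
  shows "(LINT x|lborel. f x) = integral (cbox u v) f"
proof -
  obtain b where b: "\<And>x. x \<in> cbox u v \<Longrightarrow> norm x \<le> b"
    using bounded_cbox[of u v] unfolding bounded_iff by blast
  have "(LINT x|lborel. f x) = integral UNIV f"
    using integrable_compact_support[OF cont, of b] supp b
    by (subst integral_lborel) (force simp: not_le[symmetric])+
  also have "\<dots> = integral UNIV (\<lambda>x. if x \<in> cbox u v then f x else 0)"
    using supp by (intro arg_cong[where f = "integral UNIV"]) auto
  also have "\<dots> = integral (cbox u v) f"
    by (rule integral_restrict_UNIV)
  finally show ?thesis .
qed

text \<open>All supports lie in one box, so the Leibniz rule on that box applies. Outside it
  \<open>f t x\<close> is zero for every \<open>t\<close> in the open set \<open>T\<close>, hence
  \<open>f' t x\<close> vanishes there as well.\<close>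

lemma has_field_derivative_integral_compact_support:
  fixes f f' :: "real \<Rightarrow> 'a::euclidean_space \<Rightarrow> real"
  assumes T: "open T" "convex T" "s \<in> T"
    and der: "\<And>t x. t \<in> T \<Longrightarrow> ((\<lambda>t. f t x) has_field_derivative f' t x) (at t)"
    and cont: "\<And>t. t \<in> T \<Longrightarrow> continuous_on UNIV (f t)"
    and cont': "continuous_on (T \<times> UNIV) (\<lambda>(t, x). f' t x)"
    and supp: "\<And>t x. t \<in> T \<Longrightarrow> norm x > b \<Longrightarrow> f t x = 0"
  shows "((\<lambda>t. LINT x|lborel. f t x) has_field_derivative (LINT x|lborel. f' s x)) (at s)"
proof -
  obtain u v :: 'a where uv: "cball 0 b \<subseteq> cbox u v"
    using bounded_subset_cbox_symmetric[of "cball 0 b :: 'a set"] by blast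
  have 1: "f t x = 0" if "t \<in> T" "x \<notin> cbox u v" for t x
    using supp[of t x] that uv by force
  have 2: "f' t x = 0" if "t \<in> T" "x \<notin> cbox u v" for t x
  proof -
    have "((\<lambda>t. f t x) has_field_derivative 0) (at t)"
    proof (rule DERIV_cong_ev[THEN iffD2, OF refl _ refl])
      show "\<forall>\<^sub>F t in nhds t. f t x = 0"
        using eventually_nhds_in_open[OF T(1) that(1)]
        by eventually_elim (use 1 that in auto)
    qed auto
    then show ?thesis
      using der[OF that(1)] DERIV_unique by blast
  qed
  have cont'': "continuous_on UNIV (f' t)" if "t \<in> T" for t
  proof -
    have "continuous_on UNIV (\<lambda>x. (\<lambda>(t, x). f' t x) (t, x))"
      by (rule continuous_on_compose2[OF cont']) (use that in \<open>auto intro!: continuous_intros\<close>)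
    then show ?thesis
      by simp
  qed
  have "((\<lambda>t. integral (cbox u v) (f t)) has_field_derivative integral (cbox u v) (f' s)) (at s within T)"
    using T der cont cont'
    by (intro leibniz_rule_field_derivative)
       (auto intro!: integrable_continuous intro: continuous_on_subset has_field_derivative_at_within)
  then have "((\<lambda>t. integral (cbox u v) (f t)) has_field_derivative integral (cbox u v) (f' s)) (at s)"
    unfolding at_within_open[OF T(3,1)] .
  also have "integral (cbox u v) (f' s) = (LINT x|lborel. f' s x)"
    by (rule integral_lborel_eq_cbox[OF cont''[OF T(3)] 2[OF T(3)], symmetric])
  finally show ?thesis
    by (rule has_field_derivative_transform_within_open[OF _ T(1,3)])
       (rule integral_lborel_eq_cbox[OF cont 1, symmetric])
qed

text \<open>By translation invariance the integral of \<open>f (x + t *\<^sub>R e)\<close> does not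
  depend on \<open>t\<close>, while its derivative at \<open>t = 0\<close> is the integral of
  \<open>f' x e\<close>.\<close>

lemma integral_derivative_compact_support:
  fixes f :: "'a::euclidean_space \<Rightarrow> real" and f' :: "'a \<Rightarrow> 'a \<Rightarrow> real"
  assumes der: "\<And>x. (f has_derivative f' x) (at x)"
    and cont: "continuous_on UNIV (\<lambda>x. f' x e)"
    and supp: "\<And>x. norm x > b \<Longrightarrow> f x = 0"
  shows "(LINT x|lborel. f' x e) = 0"
proof -
  have contf: "continuous_on UNIV f"
    by (rule has_derivative_continuous_on[OF der[THEN has_derivative_at_withinI]])
  have "((\<lambda>t. LINT x|lborel. f (x + t *\<^sub>R e)) has_field_derivative (LINT x|lborel. f' (x + 0 *\<^sub>R e) e)) (at 0)"
  \<comment> \<open>Bounding \<open>t\<close> by 1 keeps the supports of all translates inside one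
    ball of radius \<open>b + norm e\<close>.\<close>
  proof (rule has_field_derivative_integral_compact_support[where T = "{-1<..<1}" and b = "b + norm e"])
    fix t :: real and x
    have "((\<lambda>t. f (x + t *\<^sub>R e)) has_derivative (\<lambda>s. f' (x + t *\<^sub>R e) (s *\<^sub>R e))) (at t)"
      by (rule has_derivative_compose[where f = "\<lambda>t. x + t *\<^sub>R e", OF _ der]) (auto intro!: derivative_eq_intros)
    also have "(\<lambda>s. f' (x + t *\<^sub>R e) (s *\<^sub>R e)) = (*) (f' (x + t *\<^sub>R e) e)"
      using has_derivative_linear[OF der] by (auto simp: linear_cmul)
    finally show "((\<lambda>t. f (x + t *\<^sub>R e)) has_field_derivative f' (x + t *\<^sub>R e) e) (at t)"
      by (simp add: has_field_derivative_def)
  next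
    fix t :: real and x :: 'a assume t: "t \<in> {-1<..<1}" and "norm x > b + norm e"
    moreover have "norm x \<le> norm (x + t *\<^sub>R e) + norm (t *\<^sub>R e)"
      using norm_triangle_ineq4[of "x + t *\<^sub>R e" "t *\<^sub>R e"] by simp
    moreover have "norm (t *\<^sub>R e) \<le> norm e"
    proof -
      have "\<bar>t\<bar> \<le> 1"
        using t by auto
      from mult_right_mono[OF this norm_ge_zero] show ?thesis
        by simp
    qed
    ultimately show "f (x + t *\<^sub>R e) = 0"
      by (intro supp) linarith
  next
    show "continuous_on UNIV (\<lambda>x. f (x + t *\<^sub>R e))" for t
      by (rule continuous_on_compose2[OF contf]) (auto intro!: continuous_intros)
    show "continuous_on ({-1<..<1} \<times> UNIV) (\<lambda>(t, x). f' (x + t *\<^sub>R e) e)"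
      unfolding split_beta by (rule continuous_on_compose2[OF cont]) (auto intro!: continuous_intros)
  qed auto
  moreover have "(LINT x|lborel. f (x + t *\<^sub>R e)) = (LINT x|lborel. f x)" for t
    using integral_lborel_affine[of f 1 "t *\<^sub>R e"] borel_measurable_continuous_onI[OF contf]
    by (simp add: add.commute)
  ultimately have "((\<lambda>t::real. LINT x|lborel. f x) has_field_derivative (LINT x|lborel. f' x e)) (at 0)"
    by simp
  moreover have "((\<lambda>t::real. LINT x|lborel. f x) has_field_derivative 0) (at 0)"
    by simp
  ultimately show ?thesis
    using DERIV_unique by blast
qed

subsection \<open>The Dirac operator\<close>

definition quat_cnj :: "quat \<Rightarrow> quat" where
  "quat_cnj q = Quat (Re0 q) (- Im1 q) (- Im2 q) (- Im3 q)"

text \<open>Applied to the derivative of \<open>F\<close> at \<open>q\<close>, this is \<open>dbar F q\<close>.\<close>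

definition quat_dirac :: "(quat \<Rightarrow> quat) \<Rightarrow> quat" where
  "quat_dirac L = (\<Sum>\<alpha>\<le>3. quat_unit \<alpha> * L (quat_unit \<alpha>))"

lemma atMost_3: "{..3} = {0, 1, 2, 3::nat}"
  by auto

lemma quat_expand: "q = (\<Sum>\<alpha>\<le>3. (q \<bullet> quat_unit \<alpha>) *\<^sub>R quat_unit \<alpha>)"
  by (simp add: atMost_3 quat_eq_iff inner_quat_def)

lemma linear_quat_expand:
  assumes "linear L"
  shows "L q = (\<Sum>\<alpha>\<le>3. (q \<bullet> quat_unit \<alpha>) *\<^sub>R L (quat_unit \<alpha>))"
  by (subst quat_expand[of q]) (simp only: linear_sum[OF assms] linear_cmul[OF assms])

lemma bounded_linear_quat_cnj: "bounded_linear quat_cnj"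
  unfolding linear_conv_bounded_linear[symmetric]
  by (rule linearI) (simp_all add: quat_cnj_def quat_eq_iff)

lemmas continuous_on_quat_cnj [continuous_intros] =
  bounded_linear.continuous_on[OF bounded_linear_quat_cnj]
lemmas has_derivative_quat_cnj [derivative_intros] =
  bounded_linear.has_derivative[OF bounded_linear_quat_cnj]

lemma norm_quat_cnj [simp]: "norm (quat_cnj q) = norm q"
  by (simp add: quat_cnj_def norm_quat_def)

lemma quat_cnj_scaleR: "quat_cnj (c *\<^sub>R q) = c *\<^sub>R quat_cnj q"
  by (simp add: quat_cnj_def quat_eq_iff)

lemma quat_cnj_mult_self: "quat_cnj q * q = of_real ((norm q)\<^sup>2)"
  by (simp add: quat_cnj_def quat_eq_iff of_real_def power2_norm_eq_inner inner_quat_def)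

lemma norm_quat_unit [simp]: "\<alpha> \<le> 3 \<Longrightarrow> norm (quat_unit \<alpha>) = 1"
  by (rule norm_Basis) (simp add: Basis_quat_def)

lemma quat_dirac_scaleR: "quat_dirac (\<lambda>x. c *\<^sub>R L x) = c *\<^sub>R quat_dirac L"
  by (simp add: quat_dirac_def scaleR_sum_right)

lemma continuous_on_quat_dirac [continuous_intros]:
  assumes "\<And>x. continuous_on S (\<lambda>q. L q x)"
  shows "continuous_on S (\<lambda>q. quat_dirac (L q))"
  unfolding quat_dirac_def by (intro continuous_intros assms)

text \<open>The adjoint of left multiplication by \<open>quat_cnj q * e\<close> is left
  multiplication by its conjugate \<open>quat_cnj e * q\<close>, and the two quaternions add up to
  the real number \<open>2 * (q \<bullet> e)\<close>.\<close>

lemma inner_cnj_mult_left: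
  "v \<bullet> (quat_cnj q * (e * w)) = (2 * (q \<bullet> e)) * (v \<bullet> w) - (quat_cnj q * (e * v)) \<bullet> w"
  by (simp add: quat_cnj_def inner_quat_def algebra_simps)

text \<open>Each unit times its conjugate is 1; the factor 4 is the divergence of the identity
  field.\<close>

lemma sum_inner_cnj_unit: "(\<Sum>\<alpha>\<le>3. v \<bullet> (quat_cnj (quat_unit \<alpha>) * (quat_unit \<alpha> * w))) = 4 * (v \<bullet> w)"
  by (simp add: atMost_3 quat_cnj_def inner_quat_def)

lemma derivative_eq_0_outside_ball:
  fixes w :: "'a::real_normed_vector \<Rightarrow> 'b::real_normed_vector"
  assumes w: "(w has_derivative w') (at q)" and supp: "\<And>q. norm q > b \<Longrightarrow> w q = 0" and q: "norm q > b"
  shows "w' x = 0"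
proof -
  have "open {q :: 'a. norm q > b}"
    by (intro open_Collect_less continuous_intros)
  then have "(w has_derivative (\<lambda>_. 0)) (at q)"
    using has_derivative_transform_within_open[of "\<lambda>_. 0" "\<lambda>_. 0" q UNIV "{q. norm q > b}" w] q supp
    by simp
  then show ?thesis
    using has_derivative_unique[OF w] by metis
qed

text \<open>Integrates the divergence of the field with components \<open>v \<bullet> (q\<^sup>* \<i>\<^sub>\<alpha> w)\<close>.\<close>

lemma integral_dirac_by_parts:
  fixes v w :: "quat \<Rightarrow> quat"
  assumes v: "\<And>q. (v has_derivative v' q) (at q)" and v': "\<And>x. continuous_on UNIV (\<lambda>q. v' q x)"
    and w: "\<And>q. (w has_derivative w' q) (at q)" and w': "\<And>x. continuous_on UNIV (\<lambda>q. w' q x)"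
    and supp: "\<And>q. norm q > b \<Longrightarrow> w q = 0"
  shows "(LINT q|lborel. v q \<bullet> (quat_cnj q * quat_dirac (w' q))) =
    (LINT q|lborel. (quat_cnj q * quat_dirac (v' q) - 2 *\<^sub>R v' q q - 4 *\<^sub>R v q) \<bullet> w q)"
proof -
  have cv: "continuous_on UNIV v" and cw: "continuous_on UNIV w"
    by (rule has_derivative_continuous_on[OF v[THEN has_derivative_at_withinI]]
             has_derivative_continuous_on[OF w[THEN has_derivative_at_withinI]])+
  have linv: "linear (v' q)" for q
    using v has_derivative_linear by blast
  have cv'': "continuous_on UNIV (\<lambda>q. v' q q)"
    by (subst linear_quat_expand[OF linv]) (intro continuous_intros v')
  have w0: "w' q x = 0" if "norm q > b" for q x
    using derivative_eq_0_outside_ball[OF w _ that] supp by blast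
  \<comment> \<open>Product rule for the component of the field with index \<alpha>; the middle term
    comes from differentiating \<open>quat_cnj q\<close>.\<close>
  define f' where "f' \<alpha> q x = v' q x \<bullet> (quat_cnj q * (quat_unit \<alpha> * w q))
      + v q \<bullet> (quat_cnj x * (quat_unit \<alpha> * w q)) + v q \<bullet> (quat_cnj q * (quat_unit \<alpha> * w' q x))"
    for \<alpha> q x
  have contf': "continuous_on UNIV (\<lambda>q. f' \<alpha> q x)" for \<alpha> x
    unfolding f'_def by (intro continuous_intros v' w' cv cw)
  have int0: "(LINT q|lborel. f' \<alpha> q (quat_unit \<alpha>)) = 0" for \<alpha>
    using contf' supp
    by (intro integral_derivative_compact_support[where b = b
          and f = "\<lambda>q. v q \<bullet> (quat_cnj q * (quat_unit \<alpha> * w q))"])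
       (auto simp: f'_def inner_add_right algebra_simps intro!: derivative_eq_intros v w)
  have intf: "integrable lborel (\<lambda>q. f' \<alpha> q (quat_unit \<alpha>))" for \<alpha>
    by (rule integrable_compact_support[where b = b, OF contf']) (simp add: f'_def supp w0)
  \<comment> \<open>At \<open>x = quat_unit \<alpha>\<close> the first terms sum, by
    \<open>inner_cnj_mult_left\<close> and the expansion of \<open>q\<close> in the units, to
    \<open>2 * (v' q q \<bullet> w q)\<close> minus the Dirac term of \<open>v\<close>; the middle
    terms give \<open>4 * (v q \<bullet> w q)\<close>.\<close>
  have pw: "v q \<bullet> (quat_cnj q * quat_dirac (w' q))
      - (quat_cnj q * quat_dirac (v' q) - 2 *\<^sub>R v' q q - 4 *\<^sub>R v q) \<bullet> w q
      = (\<Sum>\<alpha>\<le>3. f' \<alpha> q (quat_unit \<alpha>))" for q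
  proof -
    have dirac: "quat_cnj q * quat_dirac L = (\<Sum>\<alpha>\<le>3. quat_cnj q * (quat_unit \<alpha> * L (quat_unit \<alpha>)))" for L
      by (simp add: quat_dirac_def sum_distrib_left)
    show ?thesis
      unfolding f'_def sum.distrib sum_inner_cnj_unit inner_cnj_mult_left[of "v' _ _"] dirac
        linear_quat_expand[OF linv, of q q]
      by (simp add: inner_sum_left inner_sum_right sum_subtractf inner_diff_left sum_distrib_left algebra_simps)
  qed
  have "(LINT q|lborel. v q \<bullet> (quat_cnj q * quat_dirac (w' q))) -
    (LINT q|lborel. (quat_cnj q * quat_dirac (v' q) - 2 *\<^sub>R v' q q - 4 *\<^sub>R v q) \<bullet> w q)
     = (LINT q|lborel. (\<Sum>\<alpha>\<le>3. f' \<alpha> q (quat_unit \<alpha>)))"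
    unfolding pw[symmetric]
    by (intro Bochner_Integration.integral_diff[symmetric] integrable_compact_support[where b = b] continuous_intros cv cv'' v' w' cw)
      (simp_all add: supp w0 quat_dirac_def)
  also have "\<dots> = 0"
    using int0 intf by (simp add: Bochner_Integration.integral_sum)
  finally show ?thesis
    by simp
qed

subsection \<open>The Carleman inequality\<close>

lemma DIM_quat: "DIM(quat) = 4"
proof -
  have "inj_on quat_unit {..3}"
    by (auto simp: inj_on_def atMost_3 quat_eq_iff)
  then show ?thesis
    by (simp add: Basis_quat_def card_image)
qed

text \<open>Cauchy-Schwarz followed by Young's inequality. The weight is tuned so that the term in
  \<open>w\<close> of the Carleman estimate can be absorbed.\<close>

lemma inner_le_weighted_squares:
  fixes x y :: "'a::real_inner"
  assumes "S > 0"
  shows "\<bar>x \<bullet> y\<bar> \<le> S / 2 * (norm x)\<^sup>2 + 1 / (2 * S) * (norm y)\<^sup>2"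
proof -
  have "0 \<le> (S * norm x - norm y)\<^sup>2"
    by simp
  then have "2 * S * (norm x * norm y) \<le> S\<^sup>2 * (norm x)\<^sup>2 + (norm y)\<^sup>2"
    by (simp add: power2_diff algebra_simps power_mult_distrib)
  then have "norm x * norm y \<le> S / 2 * (norm x)\<^sup>2 + 1 / (2 * S) * (norm y)\<^sup>2"
    using assms by (simp add: field_simps power2_eq_square)
  then show ?thesis
    using Cauchy_Schwarz_ineq2[of x y] by linarith
qed

text \<open>The factor \<open>exp (2 * s)\<close> makes the dilation unitary, as the real dimension is 4.\<close>

definition quat_dilate :: "(quat \<Rightarrow> quat) \<Rightarrow> real \<Rightarrow> quat \<Rightarrow> quat" where
  "quat_dilate f s q = exp (2 * s) *\<^sub>R f (exp s *\<^sub>R q)"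

lemma integral_norm_quat_dilate:
  assumes "continuous_on UNIV f"
  shows "(LINT q|lborel. (norm (quat_dilate f s q))\<^sup>2) = (LINT q|lborel. (norm (f q))\<^sup>2)"
proof -
  have [measurable]: "f \<in> borel_measurable borel"
    by (rule borel_measurable_continuous_onI[OF assms])
  have "(exp (2 * s))\<^sup>2 = exp s ^ 4"
    by (simp add: exp_double)
  then show ?thesis
    using integral_lborel_affine[of "\<lambda>q. (norm (f q))\<^sup>2" "exp s" 0]
    by (simp add: quat_dilate_def power_mult_distrib DIM_quat)
qed

lemma continuous_on_quat_dilate:
  assumes "continuous_on UNIV f"
  shows "continuous_on UNIV (quat_dilate f s)"
  unfolding quat_dilate_def by (intro continuous_intros continuous_on_compose2[OF assms]) auto

text \<open>
  With \<open>T\<^sub>s\<close> the dilation group, \<open>g s = \<langle>T\<^sub>s w, w\<rangle>\<close> satisfies \<open>2 g' s = \<langle>T\<^sub>s h, w\<rangle> - \<langle>T\<^sub>s w, h\<rangle>\<close>, hence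
  \<open>|g'| \<le> \<parallel>h\<parallel> \<parallel>w\<parallel>\<close>; moreover \<open>g 0 = \<parallel>w\<parallel>\<^sup>2\<close>, and \<open>g S = 0\<close> because the supports have separated.
\<close>

lemma quat_carleman:
  fixes w :: "quat \<Rightarrow> quat" and w' :: "quat \<Rightarrow> quat \<Rightarrow> quat" and a b S \<tau> :: real
  assumes w: "\<And>q. (w has_derivative w' q) (at q)" and w': "\<And>x. continuous_on UNIV (\<lambda>q. w' q x)"
    and supp: "\<And>q. norm q < a \<or> norm q > b \<Longrightarrow> w q = 0"
    and S: "S > 0" "exp S * a > b"
  defines "h \<equiv> \<lambda>q. quat_cnj q * quat_dirac (w' q) + \<tau> *\<^sub>R w q"
  shows "(LINT q|lborel. (norm (w q))\<^sup>2) \<le> S\<^sup>2 * (LINT q|lborel. (norm (h q))\<^sup>2)"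
proof -
  define B where "B q = quat_cnj q * quat_dirac (w' q)" for q
  define E where "E q = w' q q" for q
  let ?T = quat_dilate
  have cw: "continuous_on UNIV w"
    by (rule has_derivative_continuous_on[OF w[THEN has_derivative_at_withinI]])
  have linw: "linear (w' q)" for q
    using w has_derivative_linear by blast
  have cE: "continuous_on UNIV E"
    unfolding E_def by (subst linear_quat_expand[OF linw]) (intro continuous_intros w')
  have cB: "continuous_on UNIV B"
    unfolding B_def by (intro continuous_intros w')
  have h: "h q = B q + \<tau> *\<^sub>R w q" for q
    by (simp add: h_def B_def)
  have ch: "continuous_on UNIV h"
    unfolding h by (intro continuous_intros cB cw)
  have w'0: "w' q x = 0" if "norm q > b" for q x
    using derivative_eq_0_outside_ball[OF w _ that] supp by blast
  have B0: "B q = 0" and h0: "h q = 0" if "norm q > b" for q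
    using that supp by (simp_all add: w'0 quat_dirac_def B_def h)
  have Th0: "?T f s q = 0" if "norm q > exp (-s) * b" and "\<And>q. norm q > b \<Longrightarrow> f q = 0" for f s q
    unfolding quat_dilate_def using that by (auto simp: exp_minus field_simps)
  note [continuous_intros] = cw cE cB ch continuous_on_quat_dilate
  define g where "g s = (LINT q|lborel. ?T w s q \<bullet> w q)" for s
  \<comment> \<open>\<open>E\<close> is the derivative along the radial field, so
    \<open>2 *\<^sub>R w q + E q\<close> is the generator of the dilation group applied to
    \<open>w\<close>.\<close>
  define g' where "g' s = (LINT q|lborel. (2 *\<^sub>R ?T w s q + ?T E s q) \<bullet> w q)" for s
  have g': "(g has_field_derivative g' s) (at s)" for s
    unfolding g_def g'_def
  proof (rule has_field_derivative_integral_compact_support[where T = UNIV and b = b])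
    fix s q
    have "((\<lambda>s. w (exp s *\<^sub>R q)) has_derivative (\<lambda>x. w' (exp s *\<^sub>R q) ((exp s * x) *\<^sub>R q))) (at s)"
      by (rule has_derivative_compose[where f = "\<lambda>s. exp s *\<^sub>R q", OF _ w]) (auto intro!: derivative_eq_intros)
    then have we: "((\<lambda>s. w (exp s *\<^sub>R q)) has_vector_derivative w' (exp s *\<^sub>R q) (exp s *\<^sub>R q)) (at s)"
      using linear_cmul[OF linw] by (simp add: has_vector_derivative_def mult.commute flip: scaleR_scaleR)
    have e: "((\<lambda>s. exp (2 * s)) has_field_derivative exp (2 * s) * 2) (at s)"
      by (auto intro!: derivative_eq_intros)
    show "((\<lambda>s. ?T w s q \<bullet> w q) has_field_derivative (2 *\<^sub>R ?T w s q + ?T E s q) \<bullet> w q) (at s)"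
      unfolding has_real_derivative_iff_has_vector_derivative quat_dilate_def E_def
      by (intro bounded_linear.has_vector_derivative[OF bounded_linear_inner_left])
        (rule has_vector_derivative_eq_rhs[OF has_vector_derivative_scaleR[OF e we]], simp add: algebra_simps)
  next
    show "continuous_on (UNIV \<times> UNIV) (\<lambda>(s, q). (2 *\<^sub>R ?T w s q + ?T E s q) \<bullet> w q)"
      unfolding split_beta quat_dilate_def
      by (intro continuous_intros continuous_on_compose2[OF cw] continuous_on_compose2[OF cE]) auto
  qed (auto intro!: continuous_intros simp: supp)
  \<comment> \<open>Integration by parts is applied with the dilated \<open>w\<close> as first
    factor. Since \<open>quat_cnj q\<close> has degree 1 and the Dirac operator degree -1,
    \<open>B\<close> commutes with dilations; the remaining first-order and zero-order terms are
    exactly \<open>2 * g' s\<close>.\<close>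
  have key: "2 * g' s = (LINT q|lborel. ?T h s q \<bullet> w q - ?T w s q \<bullet> h q)" for s
  proof -
    define v' where "v' q x = exp (2 * s) *\<^sub>R w' (exp s *\<^sub>R q) (exp s *\<^sub>R x)" for q x
    have "(LINT q|lborel. ?T w s q \<bullet> (quat_cnj q * quat_dirac (w' q))) =
      (LINT q|lborel. (quat_cnj q * quat_dirac (v' q) - 2 *\<^sub>R v' q q - 4 *\<^sub>R ?T w s q) \<bullet> w q)"
    proof (rule integral_dirac_by_parts[OF _ _ w w', where b = b])
      fix q
      have "((\<lambda>q. w (exp s *\<^sub>R q)) has_derivative (\<lambda>x. w' (exp s *\<^sub>R q) (exp s *\<^sub>R x))) (at q)"
        by (rule has_derivative_compose[where f = "\<lambda>q. exp s *\<^sub>R q", OF _ w]) (auto intro!: derivative_eq_intros)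
      then show "(?T w s has_derivative v' q) (at q)"
        unfolding quat_dilate_def v'_def by (auto intro!: derivative_eq_intros)
    qed (auto simp: v'_def supp intro!: continuous_intros continuous_on_compose2[OF w'])
    moreover have "quat_cnj q * quat_dirac (v' q) = ?T B s q" for q
    proof -
      have "v' q = (\<lambda>x. (exp (2 * s) * exp s) *\<^sub>R w' (exp s *\<^sub>R q) x)"
        by (simp add: v'_def fun_eq_iff linear_cmul[OF linw])
      then show ?thesis
        by (simp add: quat_dilate_def B_def quat_dirac_scaleR quat_cnj_scaleR)
    qed
    moreover have "v' q q = ?T E s q" for q
      by (simp add: v'_def quat_dilate_def E_def)
    ultimately have "(LINT q|lborel. ?T w s q \<bullet> B q) =
        (LINT q|lborel. (?T B s q - 2 *\<^sub>R ?T E s q - 4 *\<^sub>R ?T w s q) \<bullet> w q)"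
      by (simp add: B_def)
    also have "\<dots> = (LINT q|lborel. ?T B s q \<bullet> w q - 2 * ((2 *\<^sub>R ?T w s q + ?T E s q) \<bullet> w q))"
      by (simp add: algebra_simps)
    also have "\<dots> = (LINT q|lborel. ?T B s q \<bullet> w q) - 2 * g' s"
      unfolding g'_def
      by (subst Bochner_Integration.integral_diff)
        (auto intro!: integrable_compact_support[where b = b] continuous_intros simp: supp)
    finally have "2 * g' s = (LINT q|lborel. ?T B s q \<bullet> w q) - (LINT q|lborel. ?T w s q \<bullet> B q)"
      by simp
    also have "\<dots> = (LINT q|lborel. ?T B s q \<bullet> w q - ?T w s q \<bullet> B q)"
      by (rule Bochner_Integration.integral_diff[symmetric])
        (auto intro!: integrable_compact_support[where b = b] continuous_intros simp: supp B0)
    \<comment> \<open>The two terms with \<tau> cancel, which makes the final constant independent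
      of \<tau>.\<close>
    also have "\<dots> = (LINT q|lborel. ?T h s q \<bullet> w q - ?T w s q \<bullet> h q)"
      by (simp add: h quat_dilate_def algebra_simps)
    finally show ?thesis .
  qed
  let ?I = "\<lambda>f. LINT q|lborel. (norm (f q :: quat))\<^sup>2"
  have int: "integrable lborel (\<lambda>q. (norm (f q :: quat))\<^sup>2)"
    if "continuous_on UNIV f" "\<And>q. norm q > b \<Longrightarrow> f q = 0" for f
    using that by (intro integrable_compact_support[where b = b] continuous_intros) auto
  have intT: "integrable lborel (\<lambda>q. (norm (?T f s q :: quat))\<^sup>2)"
    if "continuous_on UNIV f" "\<And>q. norm q > b \<Longrightarrow> f q = 0" for f s
    using that Th0 by (intro integrable_compact_support[where b = "exp (-s) * b"] continuous_intros) auto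
  have bound: "\<bar>2 * g' s\<bar> \<le> S * ?I h + ?I w / S" for s
  proof -
    have "\<bar>2 * g' s\<bar> \<le> (LINT q|lborel. \<bar>?T h s q \<bullet> w q - ?T w s q \<bullet> h q\<bar>)"
      unfolding key by (rule integral_abs_bound)
    also have "\<dots> \<le> (LINT q|lborel. (S / 2 * (norm (?T h s q))\<^sup>2 + 1 / (2 * S) * (norm (w q))\<^sup>2)
        + (S / 2 * (norm (h q))\<^sup>2 + 1 / (2 * S) * (norm (?T w s q))\<^sup>2))"
    proof (rule integral_mono)
      show "integrable lborel (\<lambda>q. \<bar>?T h s q \<bullet> w q - ?T w s q \<bullet> h q\<bar>)"
        by (auto intro!: integrable_compact_support[where b = b] continuous_intros simp: supp h0)
    next
      fix q
      show "\<bar>?T h s q \<bullet> w q - ?T w s q \<bullet> h q\<bar> \<le> (S / 2 * (norm (?T h s q))\<^sup>2 + 1 / (2 * S) * (norm (w q))\<^sup>2)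
        + (S / 2 * (norm (h q))\<^sup>2 + 1 / (2 * S) * (norm (?T w s q))\<^sup>2)"
        using inner_le_weighted_squares[OF S(1), of "?T h s q" "w q"]
          inner_le_weighted_squares[OF S(1), of "h q" "?T w s q"]
        unfolding inner_commute[of "h q"] by linarith
    qed (intro Bochner_Integration.integrable_add integrable_mult_right int intT cw ch; simp add: supp h0)
    also have "\<dots> = (S / 2 * ?I h + 1 / (2 * S) * ?I w) + (S / 2 * ?I h + 1 / (2 * S) * ?I w)"
      using int[OF cw] int[OF ch] intT[OF cw, of s] intT[OF ch, of s] supp h0
      by (simp add: integral_norm_quat_dilate cw ch)
    finally show ?thesis
      by (simp add: field_simps)
  qed
  obtain z where z: "g S - g 0 = (S - 0) * g' z"
    using MVT2[of 0 S g g'] S(1) g' by auto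
  \<comment> \<open>A point of norm at least \<open>a\<close> is carried by the dilation beyond
    radius \<open>b\<close>, so one of the two factors vanishes.\<close>
  have "?T w S q \<bullet> w q = 0" for q
  proof (cases "norm q < a")
    case False
    then have "exp S * a \<le> exp S * norm q"
      by simp
    then have "norm (exp S *\<^sub>R q) > b"
      unfolding norm_scaleR abs_exp_cancel using S(2) by linarith
    then have "w (exp S *\<^sub>R q) = 0"
      using supp by blast
    then show ?thesis
      by (simp add: quat_dilate_def)
  qed (simp add: supp)
  then have "g S = 0"
    by (simp add: g_def)
  moreover have "g 0 = ?I w"
    by (simp add: g_def quat_dilate_def power2_norm_eq_inner)
  \<comment> \<open>The bound on \<open>g'\<close> reproduces one copy of \<open>?I w\<close> on the
    right, which is absorbed by the two on the left.\<close>
  ultimately have "2 * ?I w = S * (- (2 * g' z))"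
    using z by simp
  also have "\<dots> \<le> S * (S * ?I h + ?I w / S)"
    using bound[of z] S(1) by (intro mult_left_mono) auto
  also have "\<dots> = S\<^sup>2 * ?I h + ?I w"
    using S(1) by (simp add: field_simps power2_eq_square)
  finally show ?thesis
    by simp
qed

subsection \<open>Cutoffs\<close>

text \<open>Leibniz rule for a real function times a quaternionic one: the gradient of the real
  factor, read as a quaternion, multiplies from the left.\<close>

lemma quat_dirac_product:
  "quat_dirac (\<lambda>x. c x *\<^sub>R g + p *\<^sub>R L x) = quat_dirac (\<lambda>x. of_real (c x)) * g + p *\<^sub>R quat_dirac L"
  by (simp add: quat_dirac_def sum.distrib distrib_left sum_distrib_right scaleR_sum_right of_real_def mult.assoc)

lemma quat_dirac_add: "quat_dirac (\<lambda>x. L x + L' x) = quat_dirac L + quat_dirac L'"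
  by (simp add: quat_dirac_def sum.distrib distrib_left)

lemma quat_dirac_of_real_mult: "quat_dirac (\<lambda>x. of_real (c * l x)) = c *\<^sub>R quat_dirac (\<lambda>x. of_real (l x))"
  by (simp add: quat_dirac_def scaleR_sum_right of_real_def)

lemma quat_dirac_of_real_inner: "quat_dirac (\<lambda>x. of_real (q \<bullet> x)) = q"
  by (subst (2) quat_expand[of q]) (simp add: quat_dirac_def of_real_def)

lemma norm_quat_dirac_le:
  assumes "\<And>x. norm (L x) \<le> C * norm x"
  shows "norm (quat_dirac L) \<le> 4 * C"
proof -
  have "norm (quat_dirac L) \<le> (\<Sum>\<alpha>\<le>3. norm (quat_unit \<alpha> * L (quat_unit \<alpha>)))"
    unfolding quat_dirac_def by (rule norm_sum)
  also have "\<dots> \<le> (\<Sum>\<alpha>\<le>(3::nat). C)"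
    using assms by (intro sum_mono) (metis atMost_iff mult.left_neutral mult.right_neutral norm_mult norm_quat_unit)
  finally show ?thesis
    by simp
qed

text \<open>The chain rule along the lines \<open>q + t *\<^sub>R quat_unit \<alpha>\<close>
  identifies the partial derivatives with values of the total derivative, the form used by all
  estimates.\<close>

lemma H_holomorphic_on_derivative:
  assumes "H_holomorphic_on F U"
  obtains F' where "\<And>q. q \<in> U \<Longrightarrow> (F has_derivative F' q) (at q)"
    "\<And>x. continuous_on U (\<lambda>q. F' q x)" "\<And>q. q \<in> U \<Longrightarrow> quat_dirac (F' q) = 0"
proof -
  obtain D :: "quat \<Rightarrow> quat \<Rightarrow>\<^sub>L quat" where D: "\<And>q. q \<in> U \<Longrightarrow> (F has_derivative D q) (at q)"
    and contD: "continuous_on U D"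
    using assms unfolding H_holomorphic_on_def C1_on_def by blast
  have "quat_dirac (D q) = 0" if q: "q \<in> U" for q
  proof -
    have "quat_partial \<alpha> F q = D q (quat_unit \<alpha>)" for \<alpha>
    proof -
      have "((\<lambda>t. F (q + t *\<^sub>R quat_unit \<alpha>)) has_derivative (\<lambda>t. D q (t *\<^sub>R quat_unit \<alpha>))) (at 0)"
        by (rule has_derivative_compose[where f = "\<lambda>t. q + t *\<^sub>R quat_unit \<alpha>"])
          (use D[OF q] in \<open>auto intro!: derivative_eq_intros\<close>)
      then show ?thesis
        unfolding quat_partial_def
        by (intro vector_derivative_at) (simp add: has_vector_derivative_def blinfun.scaleR_right)
    qed
    then show ?thesis
      using assms q by (auto simp: quat_dirac_def H_holomorphic_on_def dbar_def dest!: bspec[where x = q])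
  qed
  then show ?thesis
    using D contD by (intro that[of "\<lambda>q. blinfun_apply (D q)"]) (auto intro!: continuous_intros)
qed

text \<open>Squaring makes the positive part continuously differentiable at 0, which is all the
  smoothness that the cutoffs \<open>\<phi>\<close> and \<open>\<eta>\<close> need.\<close>

lemma DERIV_max_0_square: "((\<lambda>t::real. (max 0 t)\<^sup>2) has_field_derivative 2 * max 0 t) (at t)"
proof (cases t "0 :: real" rule: linorder_cases)
  case less
  have "((\<lambda>t::real. 0) has_field_derivative 0) (at t)"
    by simp
  then show ?thesis
    by (rule has_field_derivative_transform_within_open[where S = "{..<0}", THEN DERIV_cong]) (use less in auto)
next
  case greater
  have "((\<lambda>t::real. t\<^sup>2) has_field_derivative 2 * t) (at t)"
    by (auto intro!: derivative_eq_intros)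
  then show ?thesis
    by (rule has_field_derivative_transform_within_open[where S = "{0<..}", THEN DERIV_cong]) (use greater in auto)
next
  case equal
  have "((\<lambda>h::real. max 0 h) \<longlongrightarrow> 0) (at 0)"
    by (rule tendsto_eq_intros refl)+ simp
  then have "((\<lambda>h::real. (max 0 h)\<^sup>2 / h) \<longlongrightarrow> 0) (at 0)"
    by (rule Lim_transform_eventually) (auto simp: eventually_at_filter max_def power2_eq_square)
  then show ?thesis
    using equal by (simp add: DERIV_def)
qed

lemma radial_cutoff_exists:
  fixes b b' :: real
  assumes "0 < b" "b < b'"
  obtains \<phi> :: "'a::real_inner \<Rightarrow> real" and \<phi>' C
  where "\<And>q. (\<phi> has_derivative \<phi>' q) (at q)" "\<And>x. continuous_on UNIV (\<lambda>q. \<phi>' q x)"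
    "\<And>q. 0 \<le> \<phi> q" "\<And>q. \<phi> q \<le> 1" "\<And>q. norm q \<le> b \<Longrightarrow> \<phi> q = 1"
    "\<And>q x. norm q \<le> b \<Longrightarrow> \<phi>' q x = 0" "\<And>q. norm q \<ge> b' \<Longrightarrow> \<phi> q = 0"
    "C \<ge> 0" "\<And>q x. \<bar>\<phi>' q x\<bar> \<le> C * norm x"
proof -
  define d where "d = b'\<^sup>2 - b\<^sup>2"
  have d: "d > 0"
    using assms power_strict_mono[OF assms(2), of 2] by (simp add: d_def)
  define t :: "'a \<Rightarrow> real" where "t q = (q \<bullet> q - b\<^sup>2) / d" for q
  \<comment> \<open>\<open>t\<close> runs from 0 to 1 as the norm runs from \<open>b\<close> to
    \<open>b'\<close>. The inner square glues to the constant 1 at \<open>b\<close>, the outer one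
    to 0 at \<open>b'\<close>.\<close>
  define \<phi> where "\<phi> q = (max 0 (1 - (max 0 (t q))\<^sup>2))\<^sup>2" for q
  define \<phi>' where "\<phi>' q x = 2 * max 0 (1 - (max 0 (t q))\<^sup>2) * (- (2 * max 0 (t q) * (2 * (q \<bullet> x) / d)))" for q x
  have ct: "continuous_on UNIV t"
    unfolding t_def using d by (intro continuous_intros) auto
  have t_le: "t q \<le> 0 \<longleftrightarrow> norm q \<le> b" "t q \<ge> 1 \<longleftrightarrow> norm q \<ge> b'" for q
  proof -
    have "norm q \<le> b \<longleftrightarrow> q \<bullet> q \<le> b\<^sup>2" "norm q \<ge> b' \<longleftrightarrow> q \<bullet> q \<ge> b'\<^sup>2"
      using assms abs_le_square_iff[of "norm q" b] abs_le_square_iff[of b' "norm q"]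
      by (simp_all add: power2_norm_eq_inner)
    moreover have "t q \<le> 0 \<longleftrightarrow> q \<bullet> q \<le> b\<^sup>2"
      using d by (simp add: t_def divide_le_0_iff)
    moreover have "t q \<ge> 1 \<longleftrightarrow> q \<bullet> q \<ge> b'\<^sup>2"
      using d by (simp add: t_def le_divide_eq_1_pos d_def)
    ultimately show "t q \<le> 0 \<longleftrightarrow> norm q \<le> b" "t q \<ge> 1 \<longleftrightarrow> norm q \<ge> b'"
      by simp_all
  qed
  show ?thesis
  \<comment> \<open>Each of the two squares contributes a factor 2, and the derivative of
    \<open>t\<close> is at most \<open>2 * b' / d * norm x\<close> where \<phi> is nonzero.\<close>
  proof (rule that[of \<phi> \<phi>' "8 * b' / d"])
    fix q x
    have t: "(t has_derivative (\<lambda>x. 2 * (q \<bullet> x) / d)) (at q)"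
    proof -
      have "((\<lambda>q. q \<bullet> q) has_derivative (\<lambda>x. 2 * (q \<bullet> x))) (at q)"
        by (rule has_derivative_eq_rhs[OF has_derivative_inner[OF has_derivative_ident has_derivative_ident]])
          (simp add: inner_commute fun_eq_iff)
      from bounded_linear.has_derivative[OF bounded_linear_divide[of d] has_derivative_diff[OF this has_derivative_const[of "b\<^sup>2"]]]
      show ?thesis
        by (simp add: t_def[abs_def])
    qed
    note sq = DERIV_compose_FDERIV[where f = "\<lambda>t::real. (max 0 t)\<^sup>2" and s = UNIV, OF DERIV_max_0_square]
    have "((\<lambda>q. (max 0 (t q))\<^sup>2) has_derivative (\<lambda>x. 2 * (q \<bullet> x) / d * (2 * max 0 (t q)))) (at q)"
      using sq[of t, OF t] .
    then have "((\<lambda>q. 1 - (max 0 (t q))\<^sup>2) has_derivative (\<lambda>x. 0 - 2 * (q \<bullet> x) / d * (2 * max 0 (t q)))) (at q)"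
      by (intro has_derivative_diff has_derivative_const)
    note sq[of "\<lambda>q. 1 - (max 0 (t q))\<^sup>2", OF this]
    then show "(\<phi> has_derivative \<phi>' q) (at q)"
      unfolding \<phi>_def[abs_def] \<phi>'_def[abs_def]
      by (rule has_derivative_eq_rhs) (simp add: fun_eq_iff)
    show "continuous_on UNIV (\<lambda>q. \<phi>' q x)"
      unfolding \<phi>'_def using d by (intro continuous_intros ct) auto
    show "0 \<le> \<phi> q"
      by (simp add: \<phi>_def)
    show "\<phi> q \<le> 1"
      by (simp add: \<phi>_def power_le_one)
    show "\<phi> q = 1" "\<phi>' q x = 0" if "norm q \<le> b"
      using that t_le(1)[of q] by (simp_all add: \<phi>_def \<phi>'_def)
    show "\<phi> q = 0" if "norm q \<ge> b'"
    proof -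
      have "(max 0 (t q))\<^sup>2 \<ge> 1"
        using that t_le(2)[of q] by (simp add: one_le_power)
      then show ?thesis
        by (simp add: \<phi>_def)
    qed
    show "8 * b' / d \<ge> 0"
      using assms d by simp
    show "\<bar>\<phi>' q x\<bar> \<le> 8 * b' / d * norm x"
    proof (cases "norm q \<ge> b'")
      case True
      then have "(max 0 (t q))\<^sup>2 \<ge> 1"
        using t_le(2)[of q] by (simp add: one_le_power)
      then show ?thesis
        using assms d by (simp add: \<phi>'_def)
    next
      case False
      then have t1: "t q \<le> 1"
        using t_le(2)[of q] by linarith
      have "\<bar>\<phi>' q x\<bar> = 2 * max 0 (1 - (max 0 (t q))\<^sup>2) * (2 * max 0 (t q)) * (2 * \<bar>q \<bullet> x\<bar> / d)"
        using d by (simp add: \<phi>'_def abs_mult)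
      also have "\<dots> \<le> 2 * 1 * (2 * 1) * (2 * (b' * norm x) / d)"
      proof (intro mult_mono divide_right_mono)
        show "\<bar>q \<bullet> x\<bar> \<le> b' * norm x"
          using Cauchy_Schwarz_ineq2[of q x] mult_right_mono[of "norm q" b' "norm x"] False by simp
      qed (use d t1 assms in auto)
      finally show ?thesis
        by simp
    qed
  qed
qed

text \<open>The open sets \<open>W\<close> and \<open>- N\<close> cover the space, and the extension
  is \<open>f\<close> on the first and zero on the second. Hence nothing has to be known about the
  frontier of \<open>W\<close>.\<close>

lemma has_derivative_extend_zero:
  fixes f :: "'a::real_normed_vector \<Rightarrow> 'b::real_normed_vector"
  assumes W: "open W" and N: "closed N" "N \<subseteq> W"
    and f: "\<And>q. q \<in> W \<Longrightarrow> (f has_derivative f' q) (at q)"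
    and f': "\<And>x. continuous_on W (\<lambda>q. f' q x)"
    and zero: "\<And>q. q \<in> W - N \<Longrightarrow> f q = 0"
  defines "g \<equiv> \<lambda>q. if q \<in> W then f q else 0"
    and "g' \<equiv> \<lambda>q x. if q \<in> W then f' q x else 0"
  shows "(g has_derivative g' q) (at q)" "continuous_on UNIV (\<lambda>q. g' q x)"
proof -
  have 1: "(g has_derivative g' q) (at q)" if "q \<in> W" for q
    using has_derivative_transform_within_open[OF f[OF that] W that, of g] that by (simp add: g_def g'_def)
  have 2: "(g has_derivative (\<lambda>_. 0)) (at q)" if "q \<notin> N" for q
    by (rule has_derivative_transform_within_open[OF has_derivative_const, of "- N" _ 0])
      (use that N zero in \<open>auto simp: g_def\<close>)
  have 3: "g' q x = 0" if "q \<notin> N" for q x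
    using has_derivative_unique[OF 1 2, of q] that by (cases "q \<in> W") (auto simp: g'_def fun_eq_iff)
  show "(g has_derivative g' q) (at q)"
    using 1[of q] 2[of q] N by (cases "q \<in> W") (auto simp: g'_def)
  have "continuous_on (W \<union> - N) (\<lambda>q. g' q x)"
  proof (rule continuous_on_open_Un[OF W])
    show "continuous_on W (\<lambda>q. g' q x)"
      by (rule continuous_on_eq[OF f']) (simp add: g'_def)
    show "continuous_on (- N) (\<lambda>q. g' q x)"
      by (rule continuous_on_eq[OF continuous_on_const[of _ 0]]) (simp add: 3)
  qed (use N in auto)
  also have "W \<union> - N = UNIV"
    using N by auto
  finally show "continuous_on UNIV (\<lambda>q. g' q x)" .
qed

subsection \<open>Unique continuation\<close>

text \<open>The weight \<open>R\<close> stands for \<open>|q| powr -\<tau>\<close>, whose derivative produces the term in \<open>q \<bullet> x\<close>; conjugating with it cancels \<open>\<tau>\<close>.\<close>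

lemma weighted_dirac_eq:
  fixes q g :: quat and \<tau> R p0 :: real and d :: "quat \<Rightarrow> real"
  assumes "q \<noteq> 0" "quat_dirac L = 0"
  shows "quat_cnj q * quat_dirac (\<lambda>x. (- \<tau> * R * p0 / (q \<bullet> q) * (q \<bullet> x) + R * d x) *\<^sub>R g + (R * p0) *\<^sub>R L x)
      + \<tau> *\<^sub>R ((R * p0) *\<^sub>R g)
    = R *\<^sub>R (quat_cnj q * (quat_dirac (\<lambda>x. of_real (d x)) * g))"
proof -
  have 1: "quat_dirac (\<lambda>x. (- \<tau> * R * p0 / (q \<bullet> q) * (q \<bullet> x) + R * d x) *\<^sub>R g + (R * p0) *\<^sub>R L x)
      = ((- \<tau> * R * p0 / (q \<bullet> q)) *\<^sub>R q + R *\<^sub>R quat_dirac (\<lambda>x. of_real (d x))) * g"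
    unfolding quat_dirac_product of_real_add quat_dirac_add quat_dirac_of_real_mult quat_dirac_of_real_inner assms(2)
    by simp
  \<comment> \<open>The product of \<open>quat_cnj q\<close> and \<open>q\<close> is
    \<open>q \<bullet> q\<close>, which cancels the denominator.\<close>
  have 2: "quat_cnj q * (((- \<tau> * R * p0 / (q \<bullet> q)) *\<^sub>R q) * g) = - (\<tau> *\<^sub>R ((R * p0) *\<^sub>R g))"
    using assms(1) quat_cnj_mult_self[of q]
    by (simp add: of_real_def power2_norm_eq_inner flip: mult.assoc)
  show ?thesis
    unfolding 1 distrib_left distrib_right 2 by simp
qed

text \<open>The Carleman inequality with \<tau> = 2n and S = b'/a, applied to \<open>w\<close>. What
  remains of \<open>h\<close> contains only derivatives of the cutoffs: that of the truncation
  carries \<delta>, and that of \<phi> lives where the norm exceeds \<open>b\<close>, so that its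
  weight is at most the one at \<open>b\<close>.\<close>

lemma weighted_estimate:
  fixes G :: "quat \<Rightarrow> quat" and \<phi> :: "quat \<Rightarrow> real" and \<phi>' :: "quat \<Rightarrow> quat \<Rightarrow> real" and n \<delta> :: real
  assumes \<Omega>: "open \<Omega>" "\<Omega> \<subseteq> ball 0 r"
    and G: "\<And>q. q \<in> closure \<Omega> \<Longrightarrow> (G has_derivative G' q) (at q)"
    and G': "\<And>x. continuous_on (closure \<Omega>) (\<lambda>q. G' q x)"
    and dirac: "\<And>q. q \<in> closure \<Omega> \<Longrightarrow> quat_dirac (G' q) = 0"
    and zero: "\<And>q. q \<in> frontier \<Omega> \<Longrightarrow> norm q < r \<Longrightarrow> G q = 0"
    and M: "M \<ge> 1" "\<And>q. q \<in> closure \<Omega> \<Longrightarrow> norm (G q) \<le> M"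
    and L: "L \<ge> 0" "\<And>q x. q \<in> closure \<Omega> \<Longrightarrow> norm (G' q x) \<le> L * norm x"
    and ab: "0 < a" "a < b'" "0 < b" "b < b'" "b' < r" and a: "\<And>q. q \<in> \<Omega> \<Longrightarrow> a \<le> norm q"
    and \<phi>: "\<And>q. (\<phi> has_derivative \<phi>' q) (at q)" "\<And>x. continuous_on UNIV (\<lambda>q. \<phi>' q x)"
    and \<phi>_bounds: "\<And>q. 0 \<le> \<phi> q" "\<And>q. \<phi> q \<le> 1"
    and \<phi>': "\<And>q x. norm q \<le> b \<Longrightarrow> \<phi>' q x = 0" "C \<ge> 0" "\<And>q x. \<bar>\<phi>' q x\<bar> \<le> C * norm x"
    and \<phi>_0: "\<And>q. norm q \<ge> b' \<Longrightarrow> \<phi> q = 0"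
    and \<delta>: "0 < \<delta>" "\<delta> \<le> 1" and n: "n \<ge> 0"
  defines "w \<equiv> \<lambda>q. if q \<in> \<Omega> \<and> G q \<noteq> 0
      then (exp (- n * ln (q \<bullet> q)) * (\<phi> q * (max 0 (1 + \<delta> * ln (G q \<bullet> G q)))\<^sup>2)) *\<^sub>R G q else 0"
    and "X0 \<equiv> 1 + ln (M\<^sup>2)"
  shows "integrable lborel (\<lambda>q. (norm (w q))\<^sup>2)"
    and "(LINT q|lborel. (norm (w q))\<^sup>2) \<le> (b' / a)\<^sup>2 * ((4 * r * (C * X0\<^sup>2 * M + 4 * X0 * L))\<^sup>2 *
      (\<delta>\<^sup>2 * (exp (- n * ln (a\<^sup>2)))\<^sup>2 + (exp (- n * ln (b\<^sup>2)))\<^sup>2) * measure lborel (cball (0::quat) r))"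
proof -
  define W where "W = {q \<in> \<Omega>. G q \<noteq> 0}"
  \<comment> \<open>The truncation vanishes where the squared norm of \<open>G\<close> is below
    \<open>exp (- (1 / \<delta>))\<close>, and \<phi> vanishes from radius \<open>b'\<close> on; so
    the cut-off function is zero on \<open>W - N\<close>.\<close>
  define N where "N = {q \<in> closure \<Omega> \<inter> cball 0 b'. exp (- (1 / \<delta>)) \<le> G q \<bullet> G q}"
  define R where "R q = exp (- n * ln (q \<bullet> q))" for q :: quat
  define X where "X q = 1 + \<delta> * ln (G q \<bullet> G q)" for q
  define \<eta> where "\<eta> q = (max 0 (X q))\<^sup>2" for q
  define \<eta>' where "\<eta>' q x = \<delta> * (2 * (G q \<bullet> G' q x) / (G q \<bullet> G q)) * (2 * max 0 (X q))" for q x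
  define d where "d q x = \<phi>' q x * \<eta> q + \<phi> q * \<eta>' q x" for q x
  define f where "f q = (R q * (\<phi> q * \<eta> q)) *\<^sub>R G q" for q
  \<comment> \<open>Arranged in the shape of \<open>weighted_dirac_eq\<close> with \<tau> =
    2n.\<close>
  define f' where "f' q x = (- (2 * n) * R q * (\<phi> q * \<eta> q) / (q \<bullet> q) * (q \<bullet> x) + R q * d q x) *\<^sub>R G q
    + (R q * (\<phi> q * \<eta> q)) *\<^sub>R G' q x" for q x
  have cG: "continuous_on (closure \<Omega>) G"
    by (rule has_derivative_continuous_on[OF G[THEN has_derivative_at_withinI]])
  have W_closure: "W \<subseteq> closure \<Omega>"
    using closure_subset[of \<Omega>] by (auto simp: W_def)
  have pos: "q \<bullet> q > 0" "G q \<bullet> G q > 0" if "q \<in> W" for q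
    using that ab a[of q] by (auto simp: W_def)
  have "W = \<Omega> \<inter> G -` (- {0})"
    by (auto simp: W_def)
  then have W: "open W"
    using continuous_open_preimage[OF continuous_on_subset[OF cG closure_subset] \<Omega>(1), of "- {0}"]
    by (simp add: open_Compl)
  have N: "closed N"
    unfolding N_def by (intro continuous_on_closed_Collect_le continuous_intros continuous_on_subset[OF cG]) auto
  \<comment> \<open>On the frontier inside radius \<open>b' < r\<close> the function
    \<open>G\<close> is zero, whereas on \<open>N\<close> it is bounded away from zero.\<close>
  have NW: "N \<subseteq> W"
  proof
    fix q assume q: "q \<in> N"
    then have "G q \<bullet> G q > 0"
      using less_le_trans[OF exp_gt_zero] by (auto simp: N_def)
    then have "G q \<noteq> 0"
      by auto
    moreover from this have "q \<notin> frontier \<Omega>"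
      using zero[of q] q ab by (auto simp: N_def)
    ultimately show "q \<in> W"
      using q interior_open[OF \<Omega>(1)] by (auto simp: N_def W_def frontier_def)
  qed
  have f_zero: "f q = 0" if "q \<in> W - N" for q
  proof (cases "norm q \<ge> b'")
    case True
    then show ?thesis
      by (simp add: f_def \<phi>_0)
  next
    case False
    then have "G q \<bullet> G q < exp (- (1 / \<delta>))"
      using that W_closure by (auto simp: N_def)
    then have "ln (G q \<bullet> G q) < - (1 / \<delta>)"
      using pos(2)[of q] that ln_less_cancel_iff[of "G q \<bullet> G q" "exp (- (1 / \<delta>))"] by simp
    then have "X q < 0"
      using \<delta>(1) by (simp add: X_def field_simps)
    then show ?thesis
      by (simp add: f_def \<eta>_def)
  qed
  have c\<phi>: "continuous_on UNIV \<phi>"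
    by (rule has_derivative_continuous_on[OF \<phi>(1)[THEN has_derivative_at_withinI]])
  have cGW: "continuous_on W G"
    by (rule continuous_on_subset[OF cG W_closure])
  have f: "(f has_derivative f' q) (at q)" if q: "q \<in> W" for q
  proof -
    have Gq: "(G has_derivative G' q) (at q)"
      using G q W_closure by blast
    have inn: "((\<lambda>q. q \<bullet> q) has_derivative (\<lambda>x. 2 * (q \<bullet> x))) (at q)"
      by (rule has_derivative_eq_rhs[OF has_derivative_inner[OF has_derivative_ident has_derivative_ident]])
        (simp add: inner_commute fun_eq_iff)
    have inG: "((\<lambda>q. G q \<bullet> G q) has_derivative (\<lambda>x. 2 * (G q \<bullet> G' q x))) (at q)"
      by (rule has_derivative_eq_rhs[OF has_derivative_inner[OF Gq Gq]]) (simp add: inner_commute fun_eq_iff)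
    have R: "(R has_derivative (\<lambda>x. - (2 * n) * R q / (q \<bullet> q) * (q \<bullet> x))) (at q)"
    proof -
      have "((\<lambda>s. exp (- n * ln s)) has_field_derivative (R q * (- n * (1 / (q \<bullet> q))))) (at (q \<bullet> q))"
        using pos(1)[OF q] by (auto simp: R_def intro!: derivative_eq_intros)
      from DERIV_compose_FDERIV[where g = "\<lambda>q. q \<bullet> q", OF this inn]
      have "(R has_derivative (\<lambda>x. 2 * (q \<bullet> x) * (R q * (- n * (1 / (q \<bullet> q)))))) (at q)"
        unfolding R_def[abs_def] .
      then show ?thesis
        by (rule has_derivative_eq_rhs) (simp add: fun_eq_iff)
    qed
    have \<eta>: "(\<eta> has_derivative \<eta>' q) (at q)"
    proof -
      have "((\<lambda>s. 1 + \<delta> * ln s) has_field_derivative \<delta> * (1 / (G q \<bullet> G q))) (at (G q \<bullet> G q))"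
        using pos(2)[OF q] by (auto intro!: derivative_eq_intros)
      from DERIV_compose_FDERIV[where g = "\<lambda>q. G q \<bullet> G q", OF this inG]
      have "(X has_derivative (\<lambda>x. 2 * (G q \<bullet> G' q x) * (\<delta> * (1 / (G q \<bullet> G q))))) (at q)"
        unfolding X_def[abs_def] .
      from DERIV_compose_FDERIV[where f = "\<lambda>t::real. (max 0 t)\<^sup>2" and g = X, OF DERIV_max_0_square this]
      show ?thesis
        unfolding \<eta>_def[abs_def] by (rule has_derivative_eq_rhs) (simp add: fun_eq_iff \<eta>'_def)
    qed
    have "((\<lambda>q. R q * (\<phi> q * \<eta> q)) has_derivative
        (\<lambda>x. - (2 * n) * R q * (\<phi> q * \<eta> q) / (q \<bullet> q) * (q \<bullet> x) + R q * d q x)) (at q)"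
      by (rule has_derivative_eq_rhs[OF has_derivative_mult[OF R has_derivative_mult[OF \<phi>(1) \<eta>]]])
        (simp add: fun_eq_iff d_def algebra_simps)
    from has_derivative_scaleR[OF this Gq] show ?thesis
      unfolding f_def[abs_def] f'_def[abs_def] by (rule has_derivative_eq_rhs) (simp add: fun_eq_iff add.commute)
  qed
  have f'_cont: "continuous_on W (\<lambda>q. f' q x)" for x
    unfolding f'_def d_def \<eta>'_def \<eta>_def X_def R_def
    by (intro continuous_intros cGW continuous_on_subset[OF G' W_closure] continuous_on_subset[OF c\<phi>]
        continuous_on_subset[OF \<phi>(2)] ballI) (use pos in fastforce)+
  define w' where "w' q x = (if q \<in> W then f' q x else 0)" for q x
  have w_eq: "w = (\<lambda>q. if q \<in> W then f q else 0)"
    by (simp add: w_def W_def f_def R_def \<eta>_def X_def fun_eq_iff)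
  have w: "(w has_derivative w' q) (at q)" and w': "continuous_on UNIV (\<lambda>q. w' q x)" for q x
    unfolding w_eq w'_def by (rule has_derivative_extend_zero[OF W N NW f f'_cont f_zero]; assumption)+
  have w0: "w q = 0" if "norm q < a \<or> norm q > b'" for q
    using that a[of q] \<phi>_0[of q] by (auto simp: w_def)
  define h where "h q = quat_cnj q * quat_dirac (w' q) + (2 * n) *\<^sub>R w q" for q
  have h_in: "h q = R q *\<^sub>R (quat_cnj q * (quat_dirac (\<lambda>x. of_real (d q x)) * G q))" if q: "q \<in> W" for q
  proof -
    have "q \<noteq> 0" "quat_dirac (G' q) = 0"
      using pos(1)[OF q] dirac W_closure q by auto
    from weighted_dirac_eq[OF this, of "2 * n" "R q" "\<phi> q * \<eta> q" "d q" "G q"] q show ?thesis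
      by (simp add: h_def w_eq w'_def[abs_def] f_def f'_def[abs_def])
  qed
  have h_out: "h q = 0" if "q \<notin> W" for q
    using that by (simp add: h_def w_eq w'_def[abs_def] quat_dirac_def)
  have cw: "continuous_on UNIV w"
    by (rule has_derivative_continuous_on[OF w[THEN has_derivative_at_withinI]])
  have h_int: "integrable lborel (\<lambda>q. (norm (h q))\<^sup>2)"
  proof (rule integrable_compact_support)
    show "continuous_on UNIV (\<lambda>q. (norm (h q))\<^sup>2)"
      unfolding h_def by (intro continuous_intros cw w')
    show "(norm (h q))\<^sup>2 = 0" if "norm q > r" for q
    proof -
      have "q \<notin> W"
        using that \<Omega>(2) by (auto simp: W_def)
      then show ?thesis
        by (simp add: h_out)
    qed
  qed
  show "integrable lborel (\<lambda>q. (norm (w q))\<^sup>2)"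
  proof (rule integrable_compact_support)
    show "continuous_on UNIV (\<lambda>q. (norm (w q))\<^sup>2)"
      by (intro continuous_intros cw)
    show "(norm (w q))\<^sup>2 = 0" if "norm q > b'" for q
      using that w0 by simp
  qed
  define K where "K = 4 * r * (C * X0\<^sup>2 * M + 4 * X0 * L)"
  have X0: "X0 \<ge> 1"
    using M(1) by (simp add: X0_def)
  have r: "r > 0"
    using ab by simp
  have h_bound: "(norm (h q))\<^sup>2 \<le> K\<^sup>2 * (\<delta>\<^sup>2 * (exp (- n * ln (a\<^sup>2)))\<^sup>2 + (exp (- n * ln (b\<^sup>2)))\<^sup>2)" if q: "q \<in> W" for q
  proof -
    have qc: "q \<in> closure \<Omega>" and nq: "norm q \<le> r" and aq: "a \<le> norm q" and Gq: "norm (G q) > 0"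
      using q W_closure \<Omega>(2) a[of q] by (auto simp: W_def)
    have R_le: "R q \<le> exp (- n * ln (c\<^sup>2))" if "0 < c" "c \<le> norm q" for c
    proof -
      have "c\<^sup>2 \<le> q \<bullet> q"
        using power_mono[OF that(2), of 2] that(1) by (simp add: power2_norm_eq_inner)
      then have "ln (c\<^sup>2) \<le> ln (q \<bullet> q)"
        using that(1) pos(1)[OF q] by (subst ln_le_cancel_iff) auto
      then show ?thesis
        using n by (simp add: R_def mult_left_mono)
    qed
    have "G q \<bullet> G q \<le> M\<^sup>2"
      using power_mono[OF M(2)[OF qc], of 2] by (simp add: power2_norm_eq_inner)
    then have "ln (G q \<bullet> G q) \<le> ln (M\<^sup>2)"
      using pos(2)[OF q] M(1) by (subst ln_le_cancel_iff) auto
    moreover have "ln (M\<^sup>2) \<ge> 0"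
      using M(1) by simp
    ultimately have "\<delta> * ln (G q \<bullet> G q) \<le> ln (M\<^sup>2)"
      using \<delta> mult_left_mono[of "ln (G q \<bullet> G q)" "ln (M\<^sup>2)" \<delta>] mult_right_mono[of \<delta> 1 "ln (M\<^sup>2)"] by linarith
    then have X: "0 \<le> max 0 (X q)" "max 0 (X q) \<le> X0"
      using X0 by (auto simp: X_def X0_def)
    have \<eta>: "0 \<le> \<eta> q" "\<eta> q \<le> X0\<^sup>2"
      unfolding \<eta>_def using X by (auto intro!: power_mono)
    \<comment> \<open>The logarithm costs only one power of \<open>norm (G q)\<close> in the
      denominator, and the factor \<open>G q\<close> in \<open>h q\<close> cancels it.\<close>
    have \<eta>': "\<bar>\<eta>' q x\<bar> \<le> 4 * \<delta> * X0 * L / norm (G q) * norm x" for x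
    proof -
      have "\<bar>\<eta>' q x\<bar> = 4 * \<delta> * max 0 (X q) * \<bar>G q \<bullet> G' q x\<bar> / (norm (G q))\<^sup>2"
        using \<delta>(1) by (simp add: \<eta>'_def abs_mult power2_norm_eq_inner)
      also have "\<dots> \<le> 4 * \<delta> * X0 * (norm (G q) * (L * norm x)) / (norm (G q))\<^sup>2"
        using \<delta>(1) X X0 order_trans[OF Cauchy_Schwarz_ineq2 mult_left_mono[OF L(2)[OF qc] norm_ge_zero]]
        by (intro divide_right_mono mult_mono) auto
      also have "\<dots> = 4 * \<delta> * X0 * L / norm (G q) * norm x"
        using Gq by (simp add: power2_eq_square field_simps)
      finally show ?thesis .
    qed
    \<comment> \<open>\<open>D\<close> may depend on \<open>q\<close>, as it will through
      \<open>1 / norm (G q)\<close>. The factor \<open>r\<close> bounds the norm of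
      \<open>quat_cnj q\<close>, and 4 comes from \<open>norm_quat_dirac_le\<close>.\<close>
    have h_le: "norm (h q) \<le> R q * (r * (4 * D * norm (G q)))"
      if D: "\<And>x. \<bar>\<phi>' q x\<bar> * \<eta> q + \<bar>\<eta>' q x\<bar> \<le> D * norm x" for D
    proof -
      have "norm (of_real (d q x) :: quat) \<le> D * norm x" for x
      proof -
        have "\<bar>d q x\<bar> \<le> \<bar>\<phi>' q x\<bar> * \<eta> q + \<phi> q * \<bar>\<eta>' q x\<bar>"
          unfolding d_def using abs_triangle_ineq[of "\<phi>' q x * \<eta> q" "\<phi> q * \<eta>' q x"] \<eta>(1) \<phi>_bounds(1)[of q]
          by (simp add: abs_mult)
        also have "\<dots> \<le> \<bar>\<phi>' q x\<bar> * \<eta> q + \<bar>\<eta>' q x\<bar>"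
          using mult_right_mono[OF \<phi>_bounds(2)[of q] abs_ge_zero[of "\<eta>' q x"]] by simp
        also have "\<dots> \<le> D * norm x"
          by (rule D)
        finally show ?thesis
          by simp
      qed
      then have D': "norm (quat_dirac (\<lambda>x. of_real (d q x))) \<le> 4 * D"
        by (rule norm_quat_dirac_le)
      then have "0 \<le> 4 * D"
        by (rule order_trans[OF norm_ge_zero])
      with D' have "norm q * (norm (quat_dirac (\<lambda>x. of_real (d q x))) * norm (G q)) \<le> r * (4 * D * norm (G q))"
        using nq r by (intro mult_mono) auto
      then show ?thesis
        using h_in[OF q] by (simp add: norm_mult R_def)
    qed
    show ?thesis
    \<comment> \<open>Up to radius \<open>b\<close> only \<eta> varies, giving \<delta> times the
      weight at \<open>a\<close>; beyond \<open>b\<close> no power of \<delta> is gained, but the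
      weight is at most its value at \<open>b\<close>.\<close>
    proof (cases "norm q \<le> b")
      case True
      have "norm (h q) \<le> R q * (r * (4 * (4 * \<delta> * X0 * L / norm (G q)) * norm (G q)))"
        by (rule h_le) (use \<eta>' \<phi>'(1)[OF True] in simp)
      also have "\<dots> = R q * (\<delta> * (16 * r * X0 * L))"
        using Gq by simp
      also have "\<dots> \<le> exp (- n * ln (a\<^sup>2)) * (\<delta> * K)"
        using R_le[OF ab(1) aq] \<delta>(1) r X0 L(1) M(1) \<phi>'(2)
        by (intro mult_mono) (auto simp: K_def algebra_simps)
      finally have "(norm (h q))\<^sup>2 \<le> (exp (- n * ln (a\<^sup>2)) * (\<delta> * K))\<^sup>2"
        by (rule power_mono) simp
      also have "\<dots> \<le> K\<^sup>2 * (\<delta>\<^sup>2 * (exp (- n * ln (a\<^sup>2)))\<^sup>2 + (exp (- n * ln (b\<^sup>2)))\<^sup>2)"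
        by (simp add: power_mult_distrib algebra_simps)
      finally show ?thesis .
    next
      case False
      have "norm (h q) \<le> R q * (r * (4 * (C * X0\<^sup>2 + 4 * \<delta> * X0 * L / norm (G q)) * norm (G q)))"
      proof (rule h_le)
        fix x
        have "\<bar>\<phi>' q x\<bar> * \<eta> q \<le> (C * norm x) * X0\<^sup>2"
          using \<phi>'(2,3) \<eta> by (intro mult_mono) auto
        then show "\<bar>\<phi>' q x\<bar> * \<eta> q + \<bar>\<eta>' q x\<bar> \<le> (C * X0\<^sup>2 + 4 * \<delta> * X0 * L / norm (G q)) * norm x"
          using \<eta>'[of x] by (simp add: algebra_simps)
      qed
      also have "\<dots> = R q * (4 * r * (C * X0\<^sup>2 * norm (G q) + \<delta> * (4 * X0 * L)))"
        using Gq by (simp add: field_simps)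
      also have "\<dots> \<le> exp (- n * ln (b\<^sup>2)) * K"
        unfolding K_def using R_le[OF ab(3)] False \<delta> r X0 L(1) M(1) \<phi>'(2) M(2)[OF qc]
        by (intro mult_mono mult_left_mono add_mono mult_left_le_one_le) auto
      finally have "(norm (h q))\<^sup>2 \<le> (exp (- n * ln (b\<^sup>2)) * K)\<^sup>2"
        by (rule power_mono) simp
      also have "\<dots> \<le> K\<^sup>2 * (\<delta>\<^sup>2 * (exp (- n * ln (a\<^sup>2)))\<^sup>2 + (exp (- n * ln (b\<^sup>2)))\<^sup>2)"
        by (simp add: power_mult_distrib algebra_simps)
      finally show ?thesis .
    qed
  qed
  define B where "B = K\<^sup>2 * (\<delta>\<^sup>2 * (exp (- n * ln (a\<^sup>2)))\<^sup>2 + (exp (- n * ln (b\<^sup>2)))\<^sup>2)"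
  have "(LINT q|lborel. (norm (h q))\<^sup>2) \<le> (LINT q|lborel. indicator (cball (0::quat) r) q *\<^sub>R B)"
  proof (rule integral_mono[OF h_int])
    show "integrable lborel (\<lambda>q::quat. indicator (cball 0 r) q *\<^sub>R B)"
      using emeasure_bounded_finite[OF bounded_cball, of "0 :: quat" "r"]
      by (intro integrable_scaleR_left integrable_real_indicator) (auto simp: infinity_ennreal_def)
    fix q
    show "(norm (h q))\<^sup>2 \<le> indicator (cball 0 r) q *\<^sub>R B"
      using h_bound[of q] h_out[of q] \<Omega>(2) by (cases "q \<in> W") (auto simp: B_def W_def indicator_def)
  qed
  also have "\<dots> = B * measure lborel (cball (0::quat) r)"
    by simp
  finally have h_integral: "(LINT q|lborel. (norm (h q))\<^sup>2) \<le> B * measure lborel (cball (0::quat) r)" .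
  \<comment> \<open>Since exp x > x, the value S = b'/a is admissible in
    \<open>quat_carleman\<close>.\<close>
  have "exp (b' / a) > b' / a"
    using exp_ge_add_one_self[of "b' / a"] by linarith
  then have "exp (b' / a) * a > b'"
    using ab by (simp add: field_simps)
  then have "(LINT q|lborel. (norm (w q))\<^sup>2) \<le> (b' / a)\<^sup>2 * (LINT q|lborel. (norm (h q))\<^sup>2)"
    unfolding h_def using ab by (intro quat_carleman[OF w w' w0]) auto
  also have "\<dots> \<le> (b' / a)\<^sup>2 * (B * measure lborel (cball (0::quat) r))"
    using h_integral by (intro mult_left_mono) auto
  finally show "(LINT q|lborel. (norm (w q))\<^sup>2) \<le> (b' / a)\<^sup>2 * ((4 * r * (C * X0\<^sup>2 * M + 4 * X0 * L))\<^sup>2 *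
      (\<delta>\<^sup>2 * (exp (- n * ln (a\<^sup>2)))\<^sup>2 + (exp (- n * ln (b\<^sup>2)))\<^sup>2) * measure lborel (cball (0::quat) r))"
    by (simp add: B_def K_def)
qed

text \<open>If \<open>G q0\<close> were nonzero, \<open>w\<close> would have mass at least a
  constant times the squared weight at a radius \<open>A\<close> close to that of \<open>q0\<close>,
  while the estimate allows only a constant times the squared weight at a larger radius
  \<open>b\<close>. For large \<open>n\<close> the weights contradict this.\<close>

lemma vanishes_of_zero_on_inner_frontier:
  fixes G :: "quat \<Rightarrow> quat"
  assumes \<Omega>: "open \<Omega>" "\<Omega> \<subseteq> ball 0 r" "0 \<notin> closure \<Omega>"
    and G: "\<And>q. q \<in> closure \<Omega> \<Longrightarrow> (G has_derivative G' q) (at q)"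
    and G': "\<And>x. continuous_on (closure \<Omega>) (\<lambda>q. G' q x)"
    and dirac: "\<And>q. q \<in> closure \<Omega> \<Longrightarrow> quat_dirac (G' q) = 0"
    and zero: "\<And>q. q \<in> frontier \<Omega> \<Longrightarrow> norm q < r \<Longrightarrow> G q = 0"
    and q0: "q0 \<in> \<Omega>"
  shows "G q0 = 0"
proof (rule ccontr)
  assume Gq0: "G q0 \<noteq> 0"
  \<comment> \<open>The radii increase strictly from \<open>norm q0\<close> through
    \<open>A\<close>, \<open>b\<close> and \<open>b'\<close> to \<open>r\<close>. A neighbourhood of
    \<open>q0\<close> stays inside radius \<open>A\<close>, and \<phi> drops from 1 to 0 between
    \<open>b\<close> and \<open>b'\<close>.\<close>
  define A where "A = (norm q0 + r) / 2"
  define b where "b = (A + r) / 2"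
  define b' where "b' = (b + r) / 2"
  have "norm q0 < r"
    using q0 \<Omega>(2) by auto
  then have Ab: "norm q0 < A" "A < b" "b < b'" "b' < r"
    by (auto simp: A_def b_def b'_def)
  obtain a where a: "a > 0" "ball 0 a \<subseteq> - closure \<Omega>"
    using \<Omega>(3) open_contains_ball[of "- closure \<Omega>"] by auto
  have a_le: "a \<le> norm q" if "q \<in> \<Omega>" for q
    using that a(2) closure_subset[of \<Omega>] by (force simp: not_less[symmetric])
  have A: "A > 0" and b: "b > 0" and ab': "a < b'"
    using Ab a_le[OF q0] a(1) norm_ge_zero[of q0] by linarith+
  have cG: "continuous_on (closure \<Omega>) G"
    by (rule has_derivative_continuous_on[OF G[THEN has_derivative_at_withinI]])
  have "bounded \<Omega>"
    using \<Omega>(2) bounded_ball bounded_subset by blast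
  then have cpt: "compact (closure \<Omega>)"
    by (simp add: compact_eq_bounded_closed bounded_closure)
  have bnd: "\<exists>K. \<forall>q\<in>closure \<Omega>. norm (g q) \<le> K" if "continuous_on (closure \<Omega>) g" for g :: "quat \<Rightarrow> quat"
    using compact_imp_bounded[OF compact_continuous_image[OF that cpt]] unfolding bounded_iff by blast
  obtain M0 where M0: "\<And>q. q \<in> closure \<Omega> \<Longrightarrow> norm (G q) \<le> M0"
    using bnd[OF cG] by blast
  define M where "M = max 1 M0"
  have M: "M \<ge> 1" "\<And>q. q \<in> closure \<Omega> \<Longrightarrow> norm (G q) \<le> M"
    using M0 by (auto simp: M_def le_max_iff_disj)
  have "\<forall>\<alpha>. \<exists>K. \<forall>q\<in>closure \<Omega>. norm (G' q (quat_unit \<alpha>)) \<le> K"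
    using bnd[OF G'] by blast
  from choice[OF this] obtain l where
    l: "\<And>\<alpha> q. q \<in> closure \<Omega> \<Longrightarrow> norm (G' q (quat_unit \<alpha>)) \<le> l \<alpha>"
    by blast
  define L where "L = (\<Sum>\<alpha>\<le>(3::nat). l \<alpha>)"
  have q0c: "q0 \<in> closure \<Omega>"
    using q0 closure_subset by blast
  \<comment> \<open>Boundedness on the four units bounds the whole linear map. Nonnegativity of
    \<open>L\<close> is read off at a point of the closure, later \<open>q0\<close>.\<close>
  have L: "L \<ge> 0" "norm (G' q x) \<le> L * norm x" if "q \<in> closure \<Omega>" for q x
  proof -
    have l0: "l \<alpha> \<ge> 0" for \<alpha>
      using order_trans[OF norm_ge_zero l[OF that]] .
    then show "L \<ge> 0"
      by (auto simp: L_def intro: sum_nonneg)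
    have lin: "linear (G' q)"
      using G[OF that] has_derivative_linear by blast
    have "norm (G' q x) \<le> (\<Sum>\<alpha>\<le>3. norm ((x \<bullet> quat_unit \<alpha>) *\<^sub>R G' q (quat_unit \<alpha>)))"
      unfolding linear_quat_expand[OF lin, of x] by (rule norm_sum)
    also have "\<dots> \<le> (\<Sum>\<alpha>\<le>3. norm x * l \<alpha>)"
    proof (rule sum_mono)
      fix \<alpha> :: nat assume "\<alpha> \<in> {..3}"
      then have "\<bar>x \<bullet> quat_unit \<alpha>\<bar> \<le> norm x"
        using Cauchy_Schwarz_ineq2[of x "quat_unit \<alpha>"] by simp
      then show "norm ((x \<bullet> quat_unit \<alpha>) *\<^sub>R G' q (quat_unit \<alpha>)) \<le> norm x * l \<alpha>"
        using l[OF that] by (simp add: mult_mono)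
    qed
    finally show "norm (G' q x) \<le> L * norm x"
      by (simp add: L_def sum_distrib_left mult.commute)
  qed
  obtain \<phi> :: "quat \<Rightarrow> real" and \<phi>' C where \<phi>: "\<And>q. (\<phi> has_derivative \<phi>' q) (at q)"
      "\<And>x. continuous_on UNIV (\<lambda>q. \<phi>' q x)" "\<And>q. 0 \<le> \<phi> q" "\<And>q. \<phi> q \<le> 1"
    and \<phi>_1: "\<And>q. norm q \<le> b \<Longrightarrow> \<phi> q = 1"
    and \<phi>'_0: "\<And>q x. norm q \<le> b \<Longrightarrow> \<phi>' q x = 0"
    and \<phi>_0: "\<And>q. norm q \<ge> b' \<Longrightarrow> \<phi> q = 0"
    and \<phi>': "C \<ge> 0" "\<And>q x. \<bar>\<phi>' q x\<bar> \<le> C * norm x"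
    by (rule radial_cutoff_exists[OF b Ab(3)]) (rule that)
  define m where "m = (norm (G q0))\<^sup>2 / 2"
  have m: "m > 0"
    using Gq0 by (simp add: m_def)
  have "open (\<Omega> \<inter> G -` {p. m < (norm p)\<^sup>2})"
    by (intro continuous_open_preimage[OF continuous_on_subset[OF cG closure_subset] \<Omega>(1)]
        open_Collect_less continuous_intros)
  then have "open (\<Omega> \<inter> G -` {p. m < (norm p)\<^sup>2} \<inter> ball 0 A)"
    by auto
  moreover have "q0 \<in> \<Omega> \<inter> G -` {p. m < (norm p)\<^sup>2} \<inter> ball 0 A"
    using q0 Ab m by (auto simp: m_def)
  ultimately obtain \<kappa> where \<kappa>: "\<kappa> > 0" "cball q0 \<kappa> \<subseteq> \<Omega> \<inter> G -` {p. m < (norm p)\<^sup>2} \<inter> ball 0 A"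
    unfolding open_contains_cball by blast
  define v where "v = measure lborel (cball q0 \<kappa>)"
  have v: "v > 0"
    using \<kappa>(1) by (simp add: v_def content_cball_pos)
  define V where "V = measure lborel (cball (0::quat) r)"
  define K where "K = (b' / a)\<^sup>2 * (4 * r * (C * (1 + ln (M\<^sup>2))\<^sup>2 * M + 4 * (1 + ln (M\<^sup>2)) * L))\<^sup>2 * V"
  have K: "K \<ge> 0"
    by (simp add: K_def V_def)
  \<comment> \<open>The squared weight at radius \<open>c\<close>, that is
    \<open>c powr (-4n)\<close> for positive \<open>c\<close>.\<close>
  define e where "e n c = (exp (- n * ln (c\<^sup>2)))\<^sup>2" for n c :: real
  \<comment> \<open>Chosen so that \<open>1 + \<delta> * ln (G q \<bullet> G q)\<close> is at least
    1/2 wherever the squared norm of \<open>G q\<close> exceeds \<open>m\<close>; adding 1 keeps the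
    denominator positive when \<open>ln m\<close> is 0.\<close>
  define \<delta>0 where "\<delta>0 = min 1 (1 / (2 * (\<bar>ln m\<bar> + 1)))"
  have \<delta>0: "\<delta>0 > 0" "\<delta>0 \<le> 1" "\<delta>0 \<le> 1 / (2 * (\<bar>ln m\<bar> + 1))"
    unfolding \<delta>0_def by (rule min.cobounded1 min.cobounded2 | simp)+
  \<comment> \<open>The left side bounds the integral from below on
    \<open>cball q0 \<kappa>\<close>: there \<phi> is 1, the weight is at least its value at
    \<open>A\<close>, and the truncation is at least 1/4, whose square is the factor 1/16.\<close>
  have est: "m / 16 * v * e n A \<le> K * (\<delta>\<^sup>2 * e n a + e n b)" if \<delta>: "0 < \<delta>" "\<delta> \<le> \<delta>0" and n: "n \<ge> 0" for n \<delta>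
  proof -
    define w where "w q = (if q \<in> \<Omega> \<and> G q \<noteq> 0
      then (exp (- n * ln (q \<bullet> q)) * (\<phi> q * (max 0 (1 + \<delta> * ln (G q \<bullet> G q)))\<^sup>2)) *\<^sub>R G q else 0)" for q
    have "\<delta> \<le> 1"
      using \<delta>(2) \<delta>0(2) by (rule order_trans)
    note w = weighted_estimate[OF \<Omega>(1,2) G G' dirac zero M L(1)[OF q0c] L(2) a(1) ab' b Ab(3,4) a_le \<phi> \<phi>'_0 \<phi>' \<phi>_0 \<delta>(1) this n,
        folded w_def]
    have "m / 16 * v * e n A = (LINT q|lborel. indicator (cball q0 \<kappa>) q *\<^sub>R (m / 16 * e n A))"
      by (simp add: v_def)
    also have "\<dots> \<le> (LINT q|lborel. (norm (w q))\<^sup>2)"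
    proof (rule integral_mono[OF _ w(1)])
      show "integrable lborel (\<lambda>q::quat. indicator (cball q0 \<kappa>) q *\<^sub>R (m / 16 * e n A))"
        using emeasure_bounded_finite[OF bounded_cball, of "q0" "\<kappa>"]
      by (intro integrable_scaleR_left integrable_real_indicator) (auto simp: infinity_ennreal_def)
      fix q
      show "indicator (cball q0 \<kappa>) q *\<^sub>R (m / 16 * e n A) \<le> (norm (w q))\<^sup>2"
      proof (cases "q \<in> cball q0 \<kappa>")
        case True
        then have q: "q \<in> \<Omega>" "m < (norm (G q))\<^sup>2" "norm q < A"
          using \<kappa>(2) by auto
        then have Gq: "G q \<noteq> 0" "q \<noteq> 0"
          using m a_le[of q] a(1) by auto
        have "q \<bullet> q \<le> A\<^sup>2"
          using power_mono[of "norm q" A 2] q(3) by (simp add: power2_norm_eq_inner)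
        then have "ln (q \<bullet> q) \<le> ln (A\<^sup>2)"
          using Gq A by (subst ln_le_cancel_iff) auto
        then have R: "exp (- n * ln (A\<^sup>2)) \<le> exp (- n * ln (q \<bullet> q))"
          using n by (simp add: mult_left_mono)
        have "ln m \<le> ln (G q \<bullet> G q)"
          using m q(2) Gq by (subst ln_le_cancel_iff) (auto simp: power2_norm_eq_inner)
        then have "\<delta> * - ln (G q \<bullet> G q) \<le> \<delta> * (\<bar>ln m\<bar> + 1)"
          using \<delta>(1) by (intro mult_left_mono) auto
        also have "\<dots> \<le> 1 / (2 * (\<bar>ln m\<bar> + 1)) * (\<bar>ln m\<bar> + 1)"
          using order_trans[OF \<delta>(2) \<delta>0(3)] by (intro mult_right_mono) auto
        also have "\<dots> = 1 / 2"
          by (simp add: field_simps)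
        finally have X: "1 / 2 \<le> 1 + \<delta> * ln (G q \<bullet> G q)"
          by simp
        then have X': "1 / 2 \<le> max 0 (1 + \<delta> * ln (G q \<bullet> G q))"
          by (rule max.coboundedI2)
        have "m / 16 * e n A = (exp (- n * ln (A\<^sup>2)) * (1 / 2)\<^sup>2)\<^sup>2 * m"
          by (simp add: e_def power_mult_distrib power2_eq_square)
        also have "\<dots> \<le> (exp (- n * ln (q \<bullet> q)) * (max 0 (1 + \<delta> * ln (G q \<bullet> G q)))\<^sup>2)\<^sup>2 * (norm (G q))\<^sup>2"
          by (intro mult_mono power_mono) (use R X X' q(2) m in simp_all)
        also have "\<dots> = (norm (w q))\<^sup>2"
          using q(1) Gq \<phi>_1[of q] q(3) Ab by (simp add: w_def power_mult_distrib)
        finally show ?thesis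
          using True by simp
      qed simp
    qed
    also have "\<dots> \<le> K * (\<delta>\<^sup>2 * e n a + e n b)"
      using w(2) by (simp add: K_def V_def e_def mult_ac)
    finally show ?thesis .
  qed
  \<comment> \<open>With \<open>n\<close> fixed, \<delta> tends to 0 and removes the term with the
    weight at \<open>a\<close>, the largest of the three.\<close>
  have est0: "m / 16 * v * e n A \<le> K * e n b" if n: "n \<ge> 0" for n
  proof (rule tendsto_lowerbound)
    show "((\<lambda>\<delta>. K * (\<delta>\<^sup>2 * e n a + e n b)) \<longlongrightarrow> K * e n b) (at_right 0)"
      by (rule tendsto_eq_intros refl)+ simp
    show "\<forall>\<^sub>F \<delta> in at_right 0. m / 16 * v * e n A \<le> K * (\<delta>\<^sup>2 * e n a + e n b)"
      using eventually_at_right_real[OF \<delta>0(1)] by eventually_elim (use est n in auto)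
  qed simp
  define y where "y = 2 * (ln (b\<^sup>2) - ln (A\<^sup>2))"
  have y: "y > 0"
    using Ab A by (simp add: y_def power_strict_mono)
  \<comment> \<open>The ratio of the squared weights at \<open>A\<close> and \<open>b\<close> is
    \<open>exp (n * y)\<close>. This \<open>n\<close> makes \<open>m / 16 * v * (n * y)\<close>
    equal to \<open>K\<close>, so exp x > x already gives the contradiction.\<close>
  define n where "n = (K / (m / 16 * v)) / y"
  have c: "m / 16 * v > 0"
    using m v by simp
  then have n: "n \<ge> 0"
    using K y by (simp add: n_def)
  have "e n A = exp (n * y) * e n b"
    by (simp add: e_def y_def exp_double[symmetric] exp_add[symmetric] algebra_simps)
  then have "(m / 16 * v * exp (n * y)) * e n b \<le> K * e n b"
    using est0[OF n] by simp
  then have "m / 16 * v * exp (n * y) \<le> K"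
    by (rule mult_right_le_imp_le) (simp add: e_def)
  moreover have "m / 16 * v * exp (n * y) > m / 16 * v * (n * y)"
    using exp_ge_add_one_self[of "n * y"] by (intro mult_strict_left_mono[OF _ c]) linarith
  moreover have "m / 16 * v * (n * y) = K"
    using y m v by (simp add: n_def)
  ultimately show False
    by simp
qed

theorem proposition1p1:
  fixes r :: real and \<Omega> \<Gamma> \<Sigma> U U' :: "quat set" and F F' :: "quat \<Rightarrow> quat"
  assumes "r > 0"
    and "open \<Omega>" and "connected \<Omega>"
    and "\<Omega> \<subseteq> ball 0 r"
    and "0 \<notin> closure \<Omega>"
    and "frontier \<Omega> = \<Gamma> \<union> \<Sigma>"
    and "\<Gamma> \<subseteq> ball 0 r"
    and "\<Sigma> \<subseteq> frontier (ball 0 r)"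
    and "open U" and "closure \<Omega> \<subseteq> U" and "H_holomorphic_on F U"
    and "open U'" and "closure \<Omega> \<subseteq> U'" and "H_holomorphic_on F' U'"
    and "\<forall>q\<in>\<Gamma>. F q = F' q"
  shows "\<forall>q\<in>\<Omega>. F q = F' q"
proof
  fix q assume q: "q \<in> \<Omega>"
  obtain D where D: "\<And>q. q \<in> U \<Longrightarrow> (F has_derivative D q) (at q)"
    "\<And>x. continuous_on U (\<lambda>q. D q x)" "\<And>q. q \<in> U \<Longrightarrow> quat_dirac (D q) = 0"
    using H_holomorphic_on_derivative[OF assms(11)] by metis
  obtain D' where D': "\<And>q. q \<in> U' \<Longrightarrow> (F' has_derivative D' q) (at q)"
    "\<And>x. continuous_on U' (\<lambda>q. D' q x)" "\<And>q. q \<in> U' \<Longrightarrow> quat_dirac (D' q) = 0"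
    using H_holomorphic_on_derivative[OF assms(14)] by metis
  have "F q - F' q = 0"
  \<comment> \<open>The two neighbourhoods may differ, but both contain the closure of \<Omega>,
    where the difference again satisfies the linear equation.\<close>
  proof (rule vanishes_of_zero_on_inner_frontier[where G = "\<lambda>q. F q - F' q" and G' = "\<lambda>q x. D q x - D' q x",
        OF assms(2,4,5) _ _ _ _ q])
    fix p assume p: "p \<in> closure \<Omega>"
    then show "((\<lambda>q. F q - F' q) has_derivative (\<lambda>x. D p x - D' p x)) (at p)"
      using D(1) D'(1) assms(10,13) by (intro has_derivative_diff) auto
    have "quat_dirac (D p) = 0" "quat_dirac (D' p) = 0"
      using p D(3) D'(3) assms(10,13) by auto
    then show "quat_dirac (\<lambda>x. D p x - D' p x) = 0"
      by (simp add: quat_dirac_def right_diff_distrib sum_subtractf)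
  next
    show "continuous_on (closure \<Omega>) (\<lambda>q. D q x - D' q x)" for x
      by (intro continuous_on_diff continuous_on_subset[OF D(2) assms(10)] continuous_on_subset[OF D'(2) assms(13)])
  next
    fix p assume "p \<in> frontier \<Omega>" "norm p < r"
    \<comment> \<open>Points of \<Sigma> lie on the sphere of radius \<open>r\<close>, so a frontier
      point of smaller norm belongs to \<Gamma>.\<close>
    then have "p \<in> \<Gamma>"
      using assms(1,6,8) by auto
    then show "F p - F' p = 0"
      using assms(15) by simp
  qed
  then show "F q = F' q"
    by simp
qed

end
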